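(* Let $L$ be strictly convex concave, let $(\theta(0),\phi(0))$ be an initialization, let $Z\subset\mathrm{Solution}(L)$ be the set of equilibria of $L$ for which $(\theta(0),\phi(0))$ is safe, and assume $Z$ is non-empty. Then under the gradient descent ascent dynamics started at $(\theta(0),\phi(0))$, $(F(\theta(t)),G(\phi(t)))$ converges to a point in $Z$ as $t\to\infty$.
   Context: Setting: $n,m,n_1,\dots,n_n,m_1,\dots,m_m$ are positive integers, $N=\sum_i n_i$, $M=\sum_j m_j$; $f_i:\mathbb{R}^{n_i}\to\mathbb{R}$, $g_j:\mathbb{R}^{m_j}\to\mathbb{R}$ and $L:\mathbb{R}^n\times\mathbb{R}^m\to\mathbb{R}$, $(x,y)\mapsto L(x,y)$, are $C^2$. Write $\theta=(\theta_1,\dots,\theta_n)\in\mathbb{R}^N$, $\theta_i\in\mathbb{R}^{n_i}$, $\phi=(\phi_1,\dots,\phi_m)\in\mathbb{R}^M$, $\phi_j\in\mathbb{R}^{m_j}$, and $F(\theta)=(f_1(\theta_1),\dots,f_n(\theta_n))$, $G(\phi)=(g_1(\phi_1),\dots,g_m(\phi_m))$. Convex concave: $L(\cdot,y)$ is convex for every $y\in\mathbb{R}^m$ and $L(x,\cdot)$ is concave for every $x\in\mathbb{R}^n$. Strictly convex concave: $L$ is convex concave and for every $(x,y)\in\mathbb{R}^n\times\mathbb{R}^m$ either $L(\cdot,y)$ is strictly convex or $L(x,\cdot)$ is strictly concave. $\mathrm{Solution}(L)$ is the set of equilibria of $L$: pairs $(p,q)$ with $L(p,y)\le L(p,q)\le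 L(x,q)$ for all $x\in\mathbb{R}^n,y\in\mathbb{R}^m$ (for convex concave $L$, equivalently the stationary points of $L$). Gradient descent ascent (GDA) dynamics: $\dot\theta_i=-\nabla f_i(\theta_i)\,\frac{\partial L}{\partial x_i}(F(\theta),G(\phi))$, $\dot\phi_j=\nabla g_j(\phi_j)\,\frac{\partial L}{\partial y_j}(F(\theta),G(\phi))$. Gradient ascent image: for $k:\mathbb{R}^d\to\mathbb{R}$ of class $C^2$ and $x_0\in\mathbb{R}^d$, let $x:\mathbb{R}\to\mathbb{R}^d$ be the solution of $\dot x=\nabla k(x)$, $x(0)=x_0$; $\operatorname{Im}_k(x_0)$ is the image of $k\circ x:\mathbb{R}\to\mathbb{R}$. The gradient ascent trajectories of the $f_i,g_j$ are assumed to be defined for all times $t\in\mathbb{R}$. Safe: $(\theta(0),\phi(0))$ is safe for $(p,q)\in\mathrm{Solution}(L)$ if no $\theta_i(0)$ is a stationary point of $f_i$, no $\phi_j(0)$ is a stationary point of $g_j$, and $p_i\in\operatorname{Im}_{f_i}(\theta_i(0))$, $q_j\in\operatorname{Im}_{g_j}(\phi_j(0))$ for all $i,j$. *)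

theory Defs
  imports "HOL-Analysis.Analysis"
begin

(* R^D for an index set D, realised inside a larger R^'d by extending vectors with zeros.
   Its dimension is card D.  A family D :: 'n => 'd set therefore gives a family of Euclidean
   spaces whose dimensions n_i = card (D i) vary with i; every family of finite dimensions
   arises this way once 'd is large enough. *)
definition coord_space :: "'d set \<Rightarrow> (real ^ 'd::finite) set" where
  "coord_space D = {v. \<forall>k. k \<notin> D \<longrightarrow> v $ k = 0}"

(* Intended for linear subspaces S only.  Values of f outside S are irrelevant. *)
definition gradient_on :: "'a::euclidean_space set \<Rightarrow> ('a \<Rightarrow> real) \<Rightarrow> 'a \<Rightarrow> 'a" where
  "gradient_on S f x =
     (THE v. v \<in> S \<and> (f has_derivative (\<lambda>h. v \<bullet> h)) (at x within S))"

lemma gradient_on_eq: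
  assumes S: "subspace S" and x: "x \<in> S"
    and v: "v \<in> S" "(f has_derivative (\<lambda>h. v \<bullet> h)) (at x within S)"
  shows "gradient_on S f x = v"
  unfolding gradient_on_def
proof (rule the_equality)
  show "v \<in> S \<and> (f has_derivative (\<lambda>h. v \<bullet> h)) (at x within S)"
    using v by simp
next
  fix w assume w: "w \<in> S \<and> (f has_derivative (\<lambda>h. w \<bullet> h)) (at x within S)"
  define d where "d = w - v"
  have dS: "d \<in> S"
    using w v S by (simp add: d_def subspace_diff)
  have "((\<lambda>z. f z - f z) has_derivative (\<lambda>h. w \<bullet> h - v \<bullet> h)) (at x within S)"
    using w v by (intro has_derivative_diff) auto
  then have 1: "((\<lambda>z. 0) has_derivative (\<lambda>h. d \<bullet> h)) (at x within S)"
    by (simp add: d_def inner_diff_left)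
  have line: "(\<lambda>t. x + t *\<^sub>R d) ` UNIV \<subseteq> S"
    using S x dS by (auto intro: subspace_add subspace_scale)
  have 2: "((\<lambda>t. x + t *\<^sub>R d) has_derivative (\<lambda>t. t *\<^sub>R d)) (at (0::real))"
    by (auto intro!: derivative_eq_intros)
  have "((\<lambda>z. 0::real) has_derivative (\<lambda>h. d \<bullet> h))
      (at (x + 0 *\<^sub>R d) within (\<lambda>t. x + t *\<^sub>R d) ` UNIV)"
    using 1 line by (auto intro: has_derivative_subset)
  from has_derivative_in_compose[OF 2 this]
  have "((\<lambda>t. 0::real) has_derivative (\<lambda>t. d \<bullet> (t *\<^sub>R d))) (at (0::real))"
    by simp
  then have "(\<lambda>t::real. d \<bullet> (t *\<^sub>R d)) = (\<lambda>t. 0)"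
    by (rule has_derivative_unique) simp
  then have "d \<bullet> (1 *\<^sub>R d) = 0"
    by meson
  then show "w = v"
    by (simp add: d_def)
qed

(* The derivative of the gradient is given by linear maps H x on the ambient space; only their
   restriction to S matters. *)
definition C2_on :: "'a::euclidean_space set \<Rightarrow> ('a \<Rightarrow> real) \<Rightarrow> bool" where
  "C2_on S f \<longleftrightarrow>
     (\<forall>x\<in>S. f differentiable (at x within S)) \<and>
     (\<exists>H :: 'a \<Rightarrow> 'a \<Rightarrow>\<^sub>L 'a.
        (\<forall>x\<in>S. (gradient_on S f has_derivative blinfun_apply (H x)) (at x within S)) \<and>
        continuous_on S H)"

definition strictly_convex :: "('a::real_vector \<Rightarrow> real) \<Rightarrow> bool" where
  "strictly_convex h \<longleftrightarrow>
     (\<forall>x y t. x \<noteq> y \<and> 0 < t \<and> t < 1 \<longrightarrow>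
        h ((1 - t) *\<^sub>R x + t *\<^sub>R y) < (1 - t) * h x + t * h y)"

definition strictly_concave :: "('a::real_vector \<Rightarrow> real) \<Rightarrow> bool" where
  "strictly_concave h \<longleftrightarrow> strictly_convex (\<lambda>x. - h x)"

definition convex_concave :: "('a::real_vector \<times> 'b::real_vector \<Rightarrow> real) \<Rightarrow> bool" where
  "convex_concave L \<longleftrightarrow>
     (\<forall>y. convex_on UNIV (\<lambda>x. L (x, y))) \<and> (\<forall>x. concave_on UNIV (\<lambda>y. L (x, y)))"

definition strictly_convex_concave ::
    "('a::real_vector \<times> 'b::real_vector \<Rightarrow> real) \<Rightarrow> bool" where
  "strictly_convex_concave L \<longleftrightarrow>
     convex_concave L \<and>
     (\<forall>x y. strictly_convex (\<lambda>x'. L (x', y)) \<or> strictly_concave (\<lambda>y'. L (x, y')))"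

definition equilibria :: "('a \<times> 'b \<Rightarrow> real) \<Rightarrow> ('a \<times> 'b) set" where
  "equilibria L = {(p, q). \<forall>x y. L (p, y) \<le> L (p, q) \<and> L (p, q) \<le> L (x, q)}"

definition partial_x :: "((real ^ 'n::finite) \<times> 'b \<Rightarrow> real) \<Rightarrow> 'n \<Rightarrow> (real ^ 'n) \<times> 'b \<Rightarrow> real" where
  "partial_x L i = (\<lambda>(x, y). deriv (\<lambda>s. L (x + s *\<^sub>R axis i 1, y)) 0)"

definition partial_y :: "('a \<times> (real ^ 'm::finite) \<Rightarrow> real) \<Rightarrow> 'm \<Rightarrow> 'a \<times> (real ^ 'm) \<Rightarrow> real" where
  "partial_y L j = (\<lambda>(x, y). deriv (\<lambda>s. L (x, y + s *\<^sub>R axis j 1)) 0)"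

(* The map (theta_1, ..., theta_n) |-> (f_1(theta_1), ..., f_n(theta_n)). *)
definition apply_blocks :: "('n::finite \<Rightarrow> 'a \<Rightarrow> real) \<Rightarrow> 'a ^ 'n \<Rightarrow> real ^ 'n" where
  "apply_blocks f \<theta> = (\<chi> i. f i (\<theta> $ i))"

definition gradient_ascent ::
    "'a::euclidean_space set \<Rightarrow> ('a \<Rightarrow> real) \<Rightarrow> 'a \<Rightarrow> (real \<Rightarrow> 'a) \<Rightarrow> bool" where
  "gradient_ascent S k x0 x \<longleftrightarrow>
     x 0 = x0 \<and>
     (\<forall>t. x t \<in> S \<and> (x has_vector_derivative gradient_on S k (x t)) (at t))"

definition gradient_ascent_complete ::
    "'a::euclidean_space set \<Rightarrow> ('a \<Rightarrow> real) \<Rightarrow> bool" where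
  "gradient_ascent_complete S k \<longleftrightarrow> (\<forall>x0\<in>S. \<exists>x. gradient_ascent S k x0 x)"

(* For k of class C^2 on S the trajectory x is unique, so this is the range of k o x. *)
definition ascent_image ::
    "'a::euclidean_space set \<Rightarrow> ('a \<Rightarrow> real) \<Rightarrow> 'a \<Rightarrow> real set" where
  "ascent_image S k x0 = {k (x t) | x t. gradient_ascent S k x0 x}"

definition safe ::
    "('n::finite \<Rightarrow> 'd::finite set) \<Rightarrow> ('m::finite \<Rightarrow> 'e::finite set) \<Rightarrow>
     ('n \<Rightarrow> real ^ 'd \<Rightarrow> real) \<Rightarrow> ('m \<Rightarrow> real ^ 'e \<Rightarrow> real) \<Rightarrow>
     real ^ 'd ^ 'n \<Rightarrow> real ^ 'e ^ 'm \<Rightarrow> real ^ 'n \<Rightarrow> real ^ 'm \<Rightarrow> bool" where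
  "safe D E f g \<theta>0 \<phi>0 p q \<longleftrightarrow>
     (\<forall>i. gradient_on (coord_space (D i)) (f i) (\<theta>0 $ i) \<noteq> 0) \<and>
     (\<forall>j. gradient_on (coord_space (E j)) (g j) (\<phi>0 $ j) \<noteq> 0) \<and>
     (\<forall>i. p $ i \<in> ascent_image (coord_space (D i)) (f i) (\<theta>0 $ i)) \<and>
     (\<forall>j. q $ j \<in> ascent_image (coord_space (E j)) (g j) (\<phi>0 $ j))"

definition GDA ::
    "('n::finite \<Rightarrow> 'd::finite set) \<Rightarrow> ('m::finite \<Rightarrow> 'e::finite set) \<Rightarrow>
     ('n \<Rightarrow> real ^ 'd \<Rightarrow> real) \<Rightarrow> ('m \<Rightarrow> real ^ 'e \<Rightarrow> real) \<Rightarrow>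
     ((real ^ 'n) \<times> (real ^ 'm) \<Rightarrow> real) \<Rightarrow> real ^ 'd ^ 'n \<Rightarrow> real ^ 'e ^ 'm \<Rightarrow>
     (real \<Rightarrow> real ^ 'd ^ 'n) \<Rightarrow> (real \<Rightarrow> real ^ 'e ^ 'm) \<Rightarrow> bool" where
  "GDA D E f g L \<theta>0 \<phi>0 \<theta> \<phi> \<longleftrightarrow>
     \<theta> 0 = \<theta>0 \<and> \<phi> 0 = \<phi>0 \<and>
     (\<forall>t\<ge>0.
        (\<forall>i. \<theta> t $ i \<in> coord_space (D i) \<and>
          ((\<lambda>s. \<theta> s $ i) has_vector_derivative
             - (partial_x L i (apply_blocks f (\<theta> t), apply_blocks g (\<phi> t)) *\<^sub>R
                gradient_on (coord_space (D i)) (f i) (\<theta> t $ i))) (at t within {0..})) \<and>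
        (\<forall>j. \<phi> t $ j \<in> coord_space (E j) \<and>
          ((\<lambda>s. \<phi> s $ j) has_vector_derivative
             (partial_y L j (apply_blocks f (\<theta> t), apply_blocks g (\<phi> t)) *\<^sub>R
                gradient_on (coord_space (E j)) (g j) (\<phi> t $ j))) (at t within {0..})))"

end

theory Submission
  imports Defs
begin

text \<open>Along a solution of the descent ascent dynamics each block \<open>\<theta>\<^sub>i\<close> moves in the direction of the
gradient of \<open>f\<^sub>i\<close>, with a speed factor that depends on time only. By uniqueness of solutions it
therefore runs along the gradient ascent trajectory \<open>x\<^sub>i\<close> of \<open>f\<^sub>i\<close> through the initial point, with
some clock \<open>a\<^sub>i\<close> (lemma \<open>reparametrised_ascent_unique\<close>); likewise for \<open>\<phi>\<^sub>j\<close>. Write \<open>u\<close> for the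
vector of all clocks and \<open>\<kappa>\<close> for the coordinatewise map with the profiles \<open>f\<^sub>i (x\<^sub>i s)\<close> and
\<open>g\<^sub>j (y\<^sub>j s)\<close>. Then \<open>(F(\<theta>), G(\<phi>)) = \<kappa> u\<close>, and the dynamics become \<open>u' = J (\<kappa> u)\<close> with the
field \<open>J = (- \<nabla>\<^sub>x L, \<nabla>\<^sub>y L)\<close> on \<open>(real ^ 'n) \<times> (real ^ 'm)\<close>. As the starting points are not
stationary, all profiles are strictly increasing, and their ranges are the ascent images; so a safe
equilibrium is \<open>\<kappa> A\<close> for some clock vector \<open>A\<close>.

The function \<open>H u\<close>, the sum over the coordinates of the integrals of \<open>\<kappa> - \<kappa> A\<close> from \<open>A\<close> to \<open>u\<close>, is
convex, coercive and minimal at \<open>A\<close>. Its derivative along the flow is \<open>J (\<kappa> u) \<bullet> (\<kappa> u - \<kappa> A)\<close>; with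
\<open>\<kappa> u = (x, y)\<close> and \<open>\<kappa> A = (p, q)\<close> this is at most \<open>L (p, y) - L (x, q) \<le> 0\<close>. Hence solutions
stay bounded. This yields global existence (\<open>solution_exists\<close>), and by Barbalat's lemma this derivative
tends to zero. Strict convexity (or concavity) at \<open>(p, q)\<close> then makes \<open>x\<close> (or \<open>y\<close>) converge to its
equilibrium value, and a second application of Barbalat's lemma shows that all limit points are
equilibria. Since they are again of the form \<open>\<kappa> B\<close>, they are safe, and the function \<open>H\<close> with \<open>A\<close>
replaced by \<open>B\<close> decreases to zero, which gives convergence (\<open>saddle_flow_converges\<close>).\<close>

section \<open>Real functions and differential equations on the half line\<close>

text \<open>The integrand is extended to negative times by its value at zero; derivatives at \<open>0\<close> are
one-sided, as in the dynamics under study.\<close>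

lemma half_line_antiderivative:
  fixes h :: "real \<Rightarrow> 'a::euclidean_space"
  assumes "continuous_on {0..} h"
  obtains a where "a 0 = 0"
    "\<And>t. t \<ge> 0 \<Longrightarrow> (a has_vector_derivative h t) (at t within {0..})"
    "continuous_on UNIV a"
proof -
  define h' where "h' t = h (max 0 t)" for t
  have "continuous_on UNIV (h \<circ> max 0)"
    by (rule continuous_on_compose)
       (auto intro!: continuous_intros continuous_on_subset[OF assms])
  then have cont: "isCont h' x" for x
    by (simp add: h'_def[abs_def] o_def continuous_on_eq_continuous_at)
  have "\<exists>F. \<forall>x::real. (-\<infinity>::ereal) < x \<longrightarrow> x < \<infinity> \<longrightarrow> (F has_vector_derivative h' x) (at x)"
    by (rule einterval_antiderivative) (auto intro: cont)
  then obtain F where F: "\<And>x. (F has_vector_derivative h' x) (at x)" by auto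
  have F': "((\<lambda>t. F t - F 0) has_vector_derivative h' x) (at x)" for x
    using has_vector_derivative_diff[OF F has_vector_derivative_const] by simp
  show ?thesis
  proof (rule that[of "\<lambda>t. F t - F 0"])
    show "((\<lambda>t. F t - F 0) has_vector_derivative h t) (at t within {0..})" if "t \<ge> 0" for t
      using has_vector_derivative_at_within[OF F'[of t]] that by (simp add: h'_def max_def)
    show "continuous_on UNIV (\<lambda>t. F t - F 0)"
      using F' by (intro continuous_at_imp_continuous_on) (auto intro: has_vector_derivative_continuous)
  qed simp
qed

lemma nonincreasing_on_half_line:
  fixes h :: "real \<Rightarrow> real"
  assumes der: "\<And>t. t \<ge> 0 \<Longrightarrow> (h has_real_derivative h' t) (at t within {0..})"
    and neg: "\<And>t. t \<ge> 0 \<Longrightarrow> h' t \<le> 0"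
    and st: "0 \<le> s" "s \<le> t"
  shows "h t \<le> h s"
proof (rule DERIV_nonpos_imp_decreasing_open[OF st(2)])
  show "\<exists>y. (h has_real_derivative y) (at x) \<and> y \<le> 0" if "s < x" "x < t" for x
  proof -
    have "at x within {0..} = at x"
      using that st by (intro at_within_interior) auto
    then show ?thesis using der[of x] neg[of x] that st by auto
  qed
  have "continuous_on {0..} h"
    unfolding continuous_on_eq_continuous_within
    using der DERIV_continuous by blast
  then show "continuous_on {s..t} h"
    by (rule continuous_on_subset) (use st in auto)
qed

text \<open>Barbalat's lemma: if \<open>h'\<close> had size at least \<open>e\<close> at arbitrarily late times, uniform continuity would
keep it away from zero on intervals of a fixed length, and each of them would move \<open>h\<close> by a
fixed amount, which a convergent \<open>h\<close> cannot afford.\<close>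

lemma barbalat:
  fixes h :: "real \<Rightarrow> real"
  assumes der: "\<And>t. t \<ge> 0 \<Longrightarrow> (h has_real_derivative h' t) (at t within {0..})"
    and uc: "uniformly_continuous_on {0..} h'"
    and lim: "(h \<longlongrightarrow> l) at_top"
  shows "(h' \<longlongrightarrow> 0) at_top"
proof (rule tendstoI)
  fix e :: real assume "e > 0"
  with uc obtain \<delta> where \<delta>: "\<delta> > 0"
    "\<And>s t. s \<ge> 0 \<Longrightarrow> t \<ge> 0 \<Longrightarrow> dist s t < \<delta> \<Longrightarrow> dist (h' s) (h' t) < e / 2"
    unfolding uniformly_continuous_on_def by (metis atLeast_iff half_gt_zero)
  \<comment> \<open>over a step of length \<open>d\<close> the derivative \<open>h'\<close> changes by less than \<open>e / 2\<close>\<close>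
  define d where "d = \<delta> / 2"
  have d: "d > 0" "d < \<delta>" using \<delta> by (auto simp: d_def)
  have "\<forall>\<^sub>F t in at_top. dist (h t) l < e * d / 4"
    using lim \<open>e > 0\<close> d by (intro tendstoD) auto
  then obtain T where T: "\<And>t. t \<ge> T \<Longrightarrow> dist (h t) l < e * d / 4"
    unfolding eventually_at_top_linorder by blast
  have "dist (h' t) 0 < e" if t: "t \<ge> max T 0" for t
  proof -
    have "\<exists>z\<in>{t<..<t + d}. h (t + d) - h t = h' z * (t + d - t)"
    proof (rule mvt_simple)
      show "(h has_derivative (*) (h' x)) (at x within {t..t + d})" if "t \<le> x" for x
        using der[of x] that t
        by (auto simp: has_field_derivative_def intro: has_derivative_subset)
    qed (use d in auto)
    then obtain z where z: "t < z" "z < t + d" "h (t + d) - h t = h' z * d" by auto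
    have "\<bar>h (t + d) - h t\<bar> < e / 2 * d"
    proof -
      have "\<bar>h (t + d) - h t\<bar> \<le> dist (h (t + d)) l + dist (h t) l"
        by (simp add: dist_real_def)
      also have "\<dots> < e * d / 4 + e * d / 4"
        using T[of t] T[of "t + d"] t d by (intro add_strict_mono) auto
      finally show ?thesis by (simp add: mult.commute)
    qed
    then have "\<bar>h' z\<bar> < e / 2" using z(3) d by (simp add: abs_mult)
    moreover have "dist (h' z) (h' t) < e / 2"
      using \<delta>(2)[of z t] z t d by (auto simp: dist_real_def)
    ultimately show ?thesis unfolding dist_real_def by linarith
  qed
  then show "\<forall>\<^sub>F t in at_top. dist (h' t) 0 < e"
    unfolding eventually_at_top_linorder by blast
qed

text \<open>Compactness turns the implication from \<open>P w = 0\<close> to \<open>Q w = 0\<close> into a quantitative one: on the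
part of the closure of the curve where \<open>\<bar>Q\<bar> \<ge> e\<close>, the function \<open>\<bar>P\<bar>\<close> has a positive minimum.\<close>

lemma vanishing_along_bounded_curve:
  fixes u :: "real \<Rightarrow> 'a::euclidean_space" and P Q :: "'a \<Rightarrow> real"
  assumes bd: "bounded (u ` {0..})"
    and P: "continuous_on UNIV P" and Q: "continuous_on UNIV Q"
    and zero: "\<And>w. P w = 0 \<Longrightarrow> Q w = 0"
    and lim: "((\<lambda>t. P (u t)) \<longlongrightarrow> 0) at_top"
  shows "((\<lambda>t. Q (u t)) \<longlongrightarrow> 0) at_top"
proof (rule tendstoI)
  fix e :: real assume e: "e > 0"
  define C where "C = closure (u ` {0..}) \<inter> {w. e \<le> \<bar>Q w\<bar>}"
  have "closed {w. e \<le> \<bar>Q w\<bar>}"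
    using Q by (intro closed_Collect_le continuous_intros)
  then have "compact C" unfolding C_def using bd by (intro compact_Int_closed) (auto simp: compact_closure)
  have u: "u t \<in> closure (u ` {0..})" if "t \<ge> 0" for t
    using that closure_subset by fastforce
  show "\<forall>\<^sub>F t in at_top. dist (Q (u t)) 0 < e"
  proof (cases "C = {}")
    case True
    then have "dist (Q (u t)) 0 < e" if "t \<ge> 0" for t
      using u[OF that] unfolding C_def by force
    then show ?thesis by (intro eventually_mono[OF eventually_ge_at_top[of "0::real"]])
  next
    case False
    obtain w where w: "w \<in> C" "\<And>v. v \<in> C \<Longrightarrow> \<bar>P w\<bar> \<le> \<bar>P v\<bar>"
      using continuous_attains_inf[OF \<open>compact C\<close> False, of "\<lambda>w. \<bar>P w\<bar>"] P
      by (auto intro: continuous_intros continuous_on_subset)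
    have "P w \<noteq> 0" using w(1) zero[of w] e by (auto simp: C_def)
    then have "\<forall>\<^sub>F t in at_top. dist (P (u t)) 0 < \<bar>P w\<bar>" using lim by (intro tendstoD) auto
    then show ?thesis using eventually_ge_at_top[of "0::real"]
    proof eventually_elim
      case (elim t)
      then have "u t \<notin> C" using w(2)[of "u t"] by auto
      then show ?case using u[OF elim(2)] by (auto simp: C_def)
    qed
  qed
qed

text \<open>The Picard operator is a contraction on the whole half line when the distance of two curves is
measured with the weight \<open>exp (- c * t)\<close> and \<open>c\<close> exceeds the Lipschitz constant. The fixed point
is sought among the functions \<open>v t = exp (- c * t) *\<^sub>R (u t - u0)\<close>, which are bounded because \<open>W\<close>
is, so that the supremum norm makes them a complete space.\<close>

lemma global_solution_of_bounded_lipschitz: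
  fixes W :: "'a::euclidean_space \<Rightarrow> 'a"
  assumes lip: "K-lipschitz_on UNIV W" and bd: "\<And>w. norm (W w) \<le> B"
  obtains u where "u 0 = u0"
    "\<And>t. t \<ge> 0 \<Longrightarrow> (u has_vector_derivative W (u t)) (at t within {0..})"
proof -
  have K0: "K \<ge> 0" using lip by (rule lipschitz_on_nonneg)
  \<comment> \<open>any \<open>c \<ge> 2 * K\<close> gives the contraction factor \<open>1 / 2\<close>; the \<open>+ 1\<close> keeps \<open>c\<close> positive when \<open>K = 0\<close>\<close>
  define c where "c = 2 * K + 1"
  have c: "c > 0" "K / c \<le> 1 / 2" using K0 by (auto simp: c_def field_simps)
  have B0: "B \<ge> 0" using bd[of 0] norm_ge_zero order_trans by blast
  have contW: "continuous_on UNIV W" using lip by (rule lipschitz_on_continuous_on)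
  define X where "X v s = W (u0 + exp (c * s) *\<^sub>R apply_bcontfun v s)" for v :: "real \<Rightarrow>\<^sub>C 'a" and s
  have contX: "continuous_on {0..} (X v)" for v
    unfolding X_def[abs_def]
    by (rule continuous_on_compose2[OF contW]) (auto intro!: continuous_intros)
  have "\<exists>A. \<forall>v. A v 0 = 0 \<and> (\<forall>t\<ge>0. (A v has_vector_derivative X v t) (at t within {0..})) \<and>
      continuous_on UNIV (A v)"
    by (rule choice) (metis half_line_antiderivative[OF contX])
  then obtain A where A: "\<And>v. A v 0 = 0"
    "\<And>v t. t \<ge> 0 \<Longrightarrow> (A v has_vector_derivative X v t) (at t within {0..})"
    "\<And>v. continuous_on UNIV (A v)" by blast
  have grow: "norm (a t) \<le> M / c * exp (c * t)"
    if "t \<ge> 0" "a 0 = 0" and M: "M \<ge> 0"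
      "\<And>s. s \<ge> 0 \<Longrightarrow> (a has_vector_derivative a' s) (at s within {0..})"
      "\<And>s. s \<ge> 0 \<Longrightarrow> norm (a' s) \<le> M * exp (c * s)" for a a' :: "real \<Rightarrow> 'a" and M t
  proof -
    have i1: "(a' has_integral (a t - a 0)) {0..t}"
      by (rule fundamental_theorem_of_calculus)
         (use that in \<open>auto intro: has_vector_derivative_within_subset[of _ _ _ "{0..}"]\<close>)
    have i2: "((\<lambda>s. M * exp (c * s)) has_integral (M / c * exp (c * t) - M / c * exp (c * 0))) {0..t}"
      by (rule fundamental_theorem_of_calculus)
         (use that c in \<open>auto intro!: derivative_eq_intros
            simp flip: has_real_derivative_iff_has_vector_derivative\<close>)
    have "norm (a t) \<le> M / c * exp (c * t) - M / c * exp (c * 0)"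
      using integral_norm_bound_integral[of a' "{0..t}" "\<lambda>s. M * exp (c * s)"] i1 i2 that
      by (auto simp: has_integral_iff)
    also have "\<dots> \<le> M / c * exp (c * t)" using M c by simp
    finally show ?thesis .
  qed
  \<comment> \<open>the weighted Picard operator, made constant for negative times\<close>
  define Q where "Q v t = exp (- c * max 0 t) *\<^sub>R A v (max 0 t)" for v and t :: real
  have scale: "norm (exp (- c * s) *\<^sub>R x) \<le> m" if "norm x \<le> m * exp (c * s)" for x :: 'a and s m
    using mult_left_mono[OF that, of "exp (- c * s)"] by (simp add: field_simps exp_minus)
  have Qbd: "norm (Q v t) \<le> B / c" for v t
  proof -
    have "norm (X v s) \<le> B * exp (c * s)" if "s \<ge> 0" for s
    proof -
      have "norm (X v s) \<le> B * 1" using bd by (simp add: X_def)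
      also have "\<dots> \<le> B * exp (c * s)" using that B0 c by (intro mult_left_mono) auto
      finally show ?thesis .
    qed
    then show ?thesis unfolding Q_def
      by (intro scale grow) (auto intro: A B0)
  qed
  have Qcont: "continuous_on UNIV (Q v)" for v
    unfolding Q_def[abs_def]
    by (intro continuous_intros continuous_on_compose2[OF A(3)]) auto
  have Qb: "Q v \<in> bcontfun" for v
    by (rule bcontfun_normI[OF Qcont Qbd])
  define T where "T v = Bcontfun (Q v)" for v
  have T: "apply_bcontfun (T v) = Q v" for v
    by (simp add: T_def Bcontfun_inverse[OF Qb])
  have "dist (T v) (T w) \<le> 1 / 2 * dist v w" for v w
  proof (rule dist_bound)
    fix t :: real
    let ?t = "max 0 t"
    have "norm (A v ?t - A w ?t) \<le> (K * dist v w) / c * exp (c * ?t)"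
    proof (rule grow[where a = "\<lambda>t. A v t - A w t" and a' = "\<lambda>s. X v s - X w s"])
      show "((\<lambda>t. A v t - A w t) has_vector_derivative X v s - X w s) (at s within {0..})"
        if "s \<ge> 0" for s using that A by (intro has_vector_derivative_diff) auto
      fix s :: real
      have "norm (X v s - X w s) \<le> K * norm (exp (c * s) *\<^sub>R apply_bcontfun v s - exp (c * s) *\<^sub>R apply_bcontfun w s)"
        unfolding X_def using lipschitz_on_normD[OF lip] by (metis UNIV_I add_diff_cancel_left)
      also have "\<dots> = K * (exp (c * s) * dist (apply_bcontfun v s) (apply_bcontfun w s))"
        by (simp add: dist_norm flip: scaleR_diff_right)
      also have "\<dots> \<le> K * (exp (c * s) * dist v w)"
        using K0 by (intro mult_left_mono dist_bounded) auto
      finally show "norm (X v s - X w s) \<le> K * dist v w * exp (c * s)" by (simp add: mult_ac)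
    qed (use K0 in \<open>auto simp: A\<close>)
    then have "dist (Q v t) (Q w t) \<le> K * dist v w / c"
      unfolding Q_def dist_norm scaleR_diff_right[symmetric] by (rule scale)
    also have "\<dots> = K / c * dist v w" by simp
    also have "\<dots> \<le> 1 / 2 * dist v w" using c by (intro mult_right_mono) auto
    finally show "dist (apply_bcontfun (T v) t) (apply_bcontfun (T w) t) \<le> 1 / 2 * dist v w"
      by (simp add: T)
  qed
  then have "\<exists>!v. T v = v" by (intro banach_fix_type[of "1/2"]) auto
  then obtain v where v: "T v = v" by blast
  define u where "u t = u0 + A v t" for t
  have "apply_bcontfun v t = exp (- c * t) *\<^sub>R A v t" if "t \<ge> 0" for t
    using that T[of v] by (simp add: v Q_def)
  then have "X v t = W (u t)" if "t \<ge> 0" for t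
    using that by (simp add: X_def u_def exp_minus)
  then have "(u has_vector_derivative W (u t)) (at t within {0..})" if "t \<ge> 0" for t
    using has_vector_derivative_add[OF has_vector_derivative_const A(2)[OF that], of u0 v] that
    by (simp add: u_def[abs_def])
  moreover have "u 0 = u0" by (simp add: u_def A)
  ultimately show ?thesis using that by blast
qed

text \<open>Gronwall's argument: on \<open>{0..T}\<close> both curves stay in a ball on which \<open>G\<close> is Lipschitz, so their
squared distance, damped by a suitable exponential, cannot grow. The time-dependent factor \<open>\<mu>\<close> is
what makes the lemma apply both to gradient ascent (constant \<open>\<mu>\<close>) and to one block of the descent
ascent dynamics (where \<open>\<mu>\<close> is a partial derivative of \<open>L\<close> along the solution).\<close>

lemma reparametrised_flow_unique:
  fixes G :: "'a::euclidean_space \<Rightarrow> 'a" and y z :: "real \<Rightarrow> 'a"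
  assumes lip: "\<And>r. \<exists>K. K-lipschitz_on (S \<inter> cball 0 r) G"
    and \<mu>: "continuous_on {0..} \<mu>"
    and y: "\<And>t. t \<ge> 0 \<Longrightarrow> y t \<in> S"
      "\<And>t. t \<ge> 0 \<Longrightarrow> (y has_vector_derivative \<mu> t *\<^sub>R G (y t)) (at t within {0..})"
    and z: "\<And>t. t \<ge> 0 \<Longrightarrow> z t \<in> S"
      "\<And>t. t \<ge> 0 \<Longrightarrow> (z has_vector_derivative \<mu> t *\<^sub>R G (z t)) (at t within {0..})"
    and init: "y 0 = z 0" and T: "T \<ge> 0"
  shows "y T = z T"
proof -
  have cont: "continuous_on {0..T} y" "continuous_on {0..T} z" "continuous_on {0..T} \<mu>"
    using has_vector_derivative_continuous[OF y(2)] has_vector_derivative_continuous[OF z(2)] \<mu>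
    by (auto simp: continuous_on_eq_continuous_within
        intro!: continuous_within_subset[of _ "{0..}" _ "{0..T}"])
  have bdd: "\<exists>r. \<forall>t\<in>{0..T}. norm (h t) \<le> r" if "continuous_on {0..T} h" for h :: "real \<Rightarrow> 'b::real_normed_vector"
    using compact_imp_bounded[OF compact_continuous_image[OF that compact_Icc]]
    by (auto simp: bounded_iff)
  obtain r1 r2 m where b: "\<And>t. t \<in> {0..T} \<Longrightarrow> norm (y t) \<le> r1"
    "\<And>t. t \<in> {0..T} \<Longrightarrow> norm (z t) \<le> r2" "\<And>t. t \<in> {0..T} \<Longrightarrow> norm (\<mu> t) \<le> m"
    using cont[THEN bdd] by blast
  obtain K where K: "K-lipschitz_on (S \<inter> cball 0 (max r1 r2)) G" using lip by blast
  have K0: "K \<ge> 0" using K by (rule lipschitz_on_nonneg)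
  define c where "c = 2 * m * K"
  \<comment> \<open>the factor \<open>2 * m * K\<close> is the growth rate that the Lipschitz bound allows to the squared distance\<close>
  define d where "d t = exp (- c * t) * ((y t - z t) \<bullet> (y t - z t))" for t
  define v where "v t = \<mu> t *\<^sub>R (G (y t) - G (z t))" for t
  have "d T \<le> d 0"
  proof (rule DERIV_nonpos_imp_decreasing_open[OF T])
    show "continuous_on {0..T} d"
      unfolding d_def[abs_def] by (intro continuous_intros cont)
    fix t assume t: "0 < t" "t < T"
    have at: "at t within {0..} = at t"
      using t by (intro at_within_interior) auto
    have "((\<lambda>t. y t - z t) has_vector_derivative v t) (at t)"
      using has_vector_derivative_diff[OF y(2) z(2), of t] t
      by (simp add: at v_def scaleR_diff_right)
    then have dy: "((\<lambda>t. y t - z t) has_derivative (\<lambda>h. h *\<^sub>R v t)) (at t)"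
      by (simp add: has_vector_derivative_def)
    have "(d has_real_derivative exp (- c * t) * (2 * ((y t - z t) \<bullet> v t) - c * ((y t - z t) \<bullet> (y t - z t)))) (at t)"
      unfolding d_def[abs_def] has_field_derivative_def
      by (rule has_derivative_eq_rhs[OF has_derivative_mult[OF _ has_derivative_inner[OF dy dy]]])
         (auto intro!: derivative_eq_intros simp: algebra_simps inner_commute)
    moreover have "(y t - z t) \<bullet> v t \<le> m * K * ((y t - z t) \<bullet> (y t - z t))"
    proof -
      have "norm (v t) \<le> m * (K * norm (y t - z t))"
        unfolding v_def norm_scaleR
        using t b[of t] y(1)[of t] z(1)[of t] lipschitz_on_normD[OF K, of "y t" "z t"]
        by (intro mult_mono) (auto intro: order_trans[OF abs_ge_zero] simp: max_def)
      then have "norm (y t - z t) * norm (v t) \<le> norm (y t - z t) * (m * (K * norm (y t - z t)))"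
        by (intro mult_left_mono) auto
      with norm_cauchy_schwarz[of "y t - z t" "v t"] show ?thesis
        by (simp add: dot_square_norm power2_eq_square mult_ac)
    qed
    ultimately show "\<exists>D. (d has_real_derivative D) (at t) \<and> D \<le> 0"
      by (intro exI[of _ "exp (- c * t) * (2 * ((y t - z t) \<bullet> v t) - c * ((y t - z t) \<bullet> (y t - z t)))"] conjI)
         (auto simp: c_def mult_le_0_iff)
  qed
  moreover have "d 0 = 0" by (simp add: d_def init)
  ultimately have "(y T - z T) \<bullet> (y T - z T) \<le> 0"
    by (simp add: d_def mult_le_0_iff)
  then have "(y T - z T) \<bullet> (y T - z T) = 0" by (intro antisym inner_ge_zero)
  then show ?thesis by simp
qed

section \<open>Gradients relative to a subspace\<close>

text \<open>The gradient relative to \<open>S\<close> is the orthogonal projection to \<open>S\<close> of the Riesz vector of any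
derivative within \<open>S\<close>; the component orthogonal to \<open>S\<close> is invisible to increments in \<open>S\<close>.\<close>

lemma C2_on_has_gradient:
  assumes S: "subspace S" and f: "C2_on S f" and x: "x \<in> S"
  shows gradient_on_mem: "gradient_on S f x \<in> S"
    and gradient_on_has_derivative: "(f has_derivative (\<lambda>h. gradient_on S f x \<bullet> h)) (at x within S)"
proof -
  obtain D where D: "(f has_derivative D) (at x within S)"
    using f x unfolding C2_on_def differentiable_def by blast
  then have lin: "linear D" by (rule has_derivative_linear)
  define w where "w = (\<Sum>b\<in>Basis. D b *\<^sub>R b)"
  have w: "w \<bullet> h = D h" for h
  proof -
    have "D h = D (\<Sum>b\<in>Basis. (h \<bullet> b) *\<^sub>R b)" by (simp add: euclidean_representation)
    also have "\<dots> = (\<Sum>b\<in>Basis. (h \<bullet> b) * D b)" using lin by (simp add: linear_sum linear_scale)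
    also have "\<dots> = w \<bullet> h"
      by (simp add: w_def inner_sum_left inner_commute[of h] mult.commute)
    finally show ?thesis by simp
  qed
  obtain v z where v: "v \<in> span S" and z: "\<And>h. h \<in> span S \<Longrightarrow> orthogonal z h" and "w = v + z"
    using orthogonal_subspace_decomp_exists by blast
  have spanS: "span S = S" using S by simp
  have eq: "v \<bullet> h = D h" if "h \<in> S" for h
    using z[of h] that w[of h] \<open>w = v + z\<close>
    by (simp add: spanS orthogonal_def inner_add_left)
  have v': "(f has_derivative (\<lambda>h. v \<bullet> h)) (at x within S)"
    unfolding has_derivative_within
  proof
    have "\<forall>\<^sub>F y in at x within S. (1 / norm (y - x)) *\<^sub>R (f y - (f x + D (y - x))) =
       (1 / norm (y - x)) *\<^sub>R (f y - (f x + v \<bullet> (y - x)))"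
      unfolding eventually_at_filter using eq subspace_diff[OF S _ x] by (auto intro!: always_eventually)
    then show "((\<lambda>y. (1 / norm (y - x)) *\<^sub>R (f y - (f x + v \<bullet> (y - x)))) \<longlongrightarrow> 0) (at x within S)"
      using D unfolding has_derivative_within by (blast intro: Lim_transform_eventually)
  qed (rule bounded_linear_inner_right)
  have "gradient_on S f x = v"
    using gradient_on_eq[OF S x _ v'] v spanS by simp
  then show "gradient_on S f x \<in> S" "(f has_derivative (\<lambda>h. gradient_on S f x \<bullet> h)) (at x within S)"
    using v v' spanS by auto
qed

lemma C2_on_gradient_lipschitz:
  assumes S: "subspace S" and f: "C2_on S f"
  shows "\<exists>K. K-lipschitz_on (S \<inter> cball 0 r) (gradient_on S f)"
proof -
  obtain H :: "'a \<Rightarrow> 'a \<Rightarrow>\<^sub>L 'a" where H: "\<And>x. x \<in> S \<Longrightarrow> (gradient_on S f has_derivative blinfun_apply (H x)) (at x within S)"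
    and cont: "continuous_on S H"
    using f unfolding C2_on_def by blast
  let ?C = "S \<inter> cball 0 r"
  have "compact ?C" using closed_subspace[OF S] by (intro closed_Int_compact) auto
  then have "bounded (H ` ?C)"
    by (intro compact_imp_bounded compact_continuous_image continuous_on_subset[OF cont]) auto
  then obtain B where B: "B > 0" "\<And>x. x \<in> ?C \<Longrightarrow> norm (H x) \<le> B"
    unfolding bounded_pos by auto
  have "convex ?C" using S by (intro convex_Int convex_cball subspace_imp_convex)
  have "B-lipschitz_on ?C (gradient_on S f)"
  proof (rule lipschitz_onI)
    fix x y assume "x \<in> ?C" "y \<in> ?C"
    then show "dist (gradient_on S f x) (gradient_on S f y) \<le> B * dist x y"
      unfolding dist_norm
      using \<open>convex ?C\<close> B(2)
      by (intro differentiable_bound[where S = ?C and f' = "\<lambda>x. blinfun_apply (H x)"])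
         (auto intro: has_derivative_subset[OF H] simp flip: norm_blinfun.rep_eq)
  qed (use B in auto)
  then show ?thesis by blast
qed

lemma continuous_on_if_lipschitz_on_balls:
  fixes h :: "'a::real_normed_vector \<Rightarrow> 'b::metric_space"
  assumes "\<And>r. \<exists>K. K-lipschitz_on (S \<inter> cball 0 r) h"
  shows "continuous_on S h"
  unfolding continuous_on_eq_continuous_within
proof
  fix x assume x: "x \<in> S"
  obtain K where "K-lipschitz_on (S \<inter> cball 0 (norm x + 1)) h" using assms by blast
  then have "continuous_on (S \<inter> cball 0 (norm x + 1)) h" by (rule lipschitz_on_continuous_on)
  then have "continuous (at x within S \<inter> cball 0 (norm x + 1)) h"
    using x by (auto simp: continuous_on_eq_continuous_within)
  moreover have "at x within S \<inter> cball 0 (norm x + 1) = at x within S"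
    by (rule at_within_nhd[where S = "ball 0 (norm x + 1)"]) auto
  ultimately show "continuous (at x within S) h" by simp
qed

section \<open>Gradient ascent trajectories\<close>

text \<open>A gradient ascent trajectory \<open>x\<close> run with a variable clock \<open>a\<close>. Every solution of the descent
ascent dynamics consists of such curves; this is the reason why one real number per block
describes the whole state.\<close>

lemma gradient_ascent_reparametrised:
  assumes x: "gradient_ascent S f x0 x" and a: "(a has_vector_derivative c) (at t within T)"
  shows "((\<lambda>t. x (a t)) has_vector_derivative c *\<^sub>R gradient_on S f (x (a t))) (at t within T)"
proof -
  have "(x has_vector_derivative gradient_on S f (x (a t))) (at (a t) within a ` T)"
    using x by (auto simp: gradient_ascent_def intro: has_vector_derivative_at_within)
  from vector_diff_chain_within[OF a this] show ?thesis by (simp add: o_def)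
qed

lemma reparametrised_ascent_unique:
  assumes S: "subspace S" and f: "C2_on S f" and x: "gradient_ascent S f x0 x"
    and \<mu>: "continuous_on {0..} \<mu>"
    and a: "\<And>t. t \<ge> 0 \<Longrightarrow> (a has_vector_derivative \<mu> t) (at t within {0..})" 
    and y: "\<And>t. t \<ge> 0 \<Longrightarrow> y t \<in> S"
      "\<And>t. t \<ge> 0 \<Longrightarrow> (y has_vector_derivative \<mu> t *\<^sub>R gradient_on S f (y t)) (at t within {0..})"
      "y 0 = x (a 0)"
    and "t \<ge> 0"
  shows "y t = x (a t)"
proof (rule reparametrised_flow_unique[where G = "gradient_on S f" and z = "\<lambda>t. x (a t)",
      OF C2_on_gradient_lipschitz[OF S f] \<mu> y(1,2) _ _ y(3) \<open>t \<ge> 0\<close>])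
  show "x (a s) \<in> S" for s using x by (simp add: gradient_ascent_def)
  show "((\<lambda>s. x (a s)) has_vector_derivative \<mu> s *\<^sub>R gradient_on S f (x (a s))) (at s within {0..})"
    if "s \<ge> 0" for s by (rule gradient_ascent_reparametrised[OF x a[OF that]])
qed

lemma gradient_ascent_unique:
  assumes S: "subspace S" and f: "C2_on S f"
    and x: "gradient_ascent S f x0 x" and y: "gradient_ascent S f x0 y"
  shows "y s = x s"
proof -
  have d: "((\<lambda>t. t * s) has_vector_derivative s) (at t within T)" for t T
    by (auto intro!: derivative_eq_intros simp flip: has_real_derivative_iff_has_vector_derivative)
  have "y (1 * s) = x (1 * s)"
  proof (rule reparametrised_ascent_unique[where a = "\<lambda>t. t * s" and \<mu> = "\<lambda>_. s"
        and y = "\<lambda>t. y (t * s)", OF S f x continuous_on_const d])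
    show "((\<lambda>t. y (t * s)) has_vector_derivative s *\<^sub>R gradient_on S f (y (t * s))) (at t within {0..})" for t
      by (rule gradient_ascent_reparametrised[OF y d])
  qed (use x y in \<open>simp_all add: gradient_ascent_def\<close>)
  then show ?thesis by simp
qed

text \<open>Otherwise the constant curve at \<open>x s\<close> and the trajectory run backwards from time \<open>s\<close> to time \<open>0\<close>
would solve the same equation with the same initial value, so \<open>x0\<close> would be stationary.\<close>

lemma gradient_ascent_nonstationary:
  assumes S: "subspace S" and f: "C2_on S f" and x: "gradient_ascent S f x0 x"
    and ns: "gradient_on S f x0 \<noteq> 0"
  shows "gradient_on S f (x s) \<noteq> 0"
proof
  assume st: "gradient_on S f (x s) = 0"
  \<comment> \<open>the clock \<open>s - t * s\<close> leads from \<open>s\<close> back to \<open>0\<close>\<close>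
  have d: "((\<lambda>t. s - t * s) has_vector_derivative - s) (at t within T)" for t T
    by (auto intro!: derivative_eq_intros simp flip: has_real_derivative_iff_has_vector_derivative)
  have "x s = x (s - 1 * s)"
    by (rule reparametrised_ascent_unique[where a = "\<lambda>t. s - t * s" and \<mu> = "\<lambda>_. - s"
        and y = "\<lambda>t. x s", OF S f x continuous_on_const d])
       (use x st in \<open>simp_all add: gradient_ascent_def\<close>)
  moreover have "x 0 = x0" using x by (simp add: gradient_ascent_def)
  ultimately show False using st ns by simp
qed

text \<open>The value of \<open>f\<close> along its own gradient ascent has the squared gradient norm as its derivative.
So if the starting point is not stationary, this profile is a strictly increasing bijection of the
real line onto the ascent image: clock and function value determine each other.\<close>

lemma gradient_ascent_profile:
  assumes S: "subspace S" and f: "C2_on S f" and x: "gradient_ascent S f x0 x"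
  shows profile_derivative: "((\<lambda>s. f (x s)) has_real_derivative
      gradient_on S f (x s) \<bullet> gradient_on S f (x s)) (at s)"
    and profile_strict_mono: "gradient_on S f x0 \<noteq> 0 \<Longrightarrow> strict_mono (\<lambda>s. f (x s))"
    and profile_lipschitz: "\<exists>K. K-lipschitz_on {-r..r} (\<lambda>s. f (x s))"
    and profile_range: "ascent_image S f x0 = range (\<lambda>s. f (x s))"
proof -
  let ?G = "gradient_on S f"
  have mem: "x s \<in> S" and dx: "(x has_vector_derivative ?G (x s)) (at s)" for s
    using x by (auto simp: gradient_ascent_def)
  show der: "((\<lambda>s. f (x s)) has_real_derivative ?G (x s) \<bullet> ?G (x s)) (at s)" for s
  proof -
    have "(f has_derivative (\<lambda>h. ?G (x s) \<bullet> h)) (at (x s) within range x)"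
      using gradient_on_has_derivative[OF S f mem] mem by (auto intro: has_derivative_subset)
    from has_derivative_in_compose[OF dx[unfolded has_vector_derivative_def] this]
    show ?thesis
      unfolding has_field_derivative_def
      by (rule has_derivative_eq_rhs) (simp add: fun_eq_iff mult.commute)
  qed
  show "strict_mono (\<lambda>s. f (x s))" if ns: "?G x0 \<noteq> 0"
  proof (rule strict_monoI)
    fix s t :: real assume "s < t"
    then show "f (x s) < f (x t)"
    proof (rule DERIV_pos_imp_increasing)
      show "\<exists>y. ((\<lambda>s. f (x s)) has_real_derivative y) (at r) \<and> 0 < y" for r
        using der[of r] gradient_ascent_nonstationary[OF S f x ns, of r]
        by (intro exI[of _ "?G (x r) \<bullet> ?G (x r)"]) simp
    qed
  qed
  have contx: "continuous_on UNIV x"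
    using dx by (intro continuous_at_imp_continuous_on) (auto dest: has_vector_derivative_continuous)
  have "continuous_on S ?G"
    by (rule continuous_on_if_lipschitz_on_balls) (rule C2_on_gradient_lipschitz[OF S f])
  then have "continuous_on UNIV (\<lambda>s. ?G (x s))"
    by (rule continuous_on_compose2[OF _ contx]) (use mem in auto)
  then have "continuous_on {-r..r} (\<lambda>s. ?G (x s) \<bullet> ?G (x s))"
    by (intro continuous_on_inner) (rule continuous_on_subset, assumption, simp)+
  then have "bounded ((\<lambda>s. ?G (x s) \<bullet> ?G (x s)) ` {-r..r})"
    by (intro compact_imp_bounded compact_continuous_image) auto
  then obtain K where K: "K > 0" "\<And>s. s \<in> {-r..r} \<Longrightarrow> norm (?G (x s) \<bullet> ?G (x s)) \<le> K"
    unfolding bounded_pos by auto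
  have "K-lipschitz_on {-r..r} (\<lambda>s. f (x s))"
  proof (rule lipschitz_onI)
    fix s t assume "s \<in> {-r..r}" "t \<in> {-r..r}"
    then show "dist (f (x s)) (f (x t)) \<le> K * dist s t"
      unfolding dist_norm
      by (intro field_differentiable_bound[where S = "{-r..r}"
            and f' = "\<lambda>s. ?G (x s) \<bullet> ?G (x s)", OF _ has_field_derivative_at_within[OF der] K(2)])
         simp_all
  qed (use K in auto)
  then show "\<exists>K. K-lipschitz_on {-r..r} (\<lambda>s. f (x s))" by blast
  show "ascent_image S f x0 = range (\<lambda>s. f (x s))"
  proof
    show "ascent_image S f x0 \<subseteq> range (\<lambda>s. f (x s))"
    proof
      fix c assume "c \<in> ascent_image S f x0"
      then obtain y s where "gradient_ascent S f x0 y" "c = f (y s)"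
        unfolding ascent_image_def by blast
      then show "c \<in> range (\<lambda>s. f (x s))"
        using gradient_ascent_unique[OF S f x, of y s] by simp
    qed
    show "range (\<lambda>s. f (x s)) \<subseteq> ascent_image S f x0"
      unfolding ascent_image_def using x by blast
  qed
qed

section \<open>Flows through coordinatewise increasing maps\<close>

text \<open>The coordinates are indexed by the basis vectors, so that the map makes sense on a product such
as \<open>(real ^ 'n) \<times> (real ^ 'm)\<close> with a different profile in each coordinate.\<close>

definition coordwise :: "('a \<Rightarrow> real \<Rightarrow> real) \<Rightarrow> 'a::euclidean_space \<Rightarrow> 'a" where
  "coordwise k u = (\<Sum>b\<in>Basis. k b (u \<bullet> b) *\<^sub>R b)"

lemma coordwise_inner: "b \<in> Basis \<Longrightarrow> coordwise k u \<bullet> b = k b (u \<bullet> b)"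
  by (simp add: coordwise_def inner_sum_left_Basis)

text \<open>\<open>P\<close> is the primitive of \<open>k - k a\<close> that vanishes at \<open>a\<close>. It is convex as \<open>k\<close> is monotone, and
the bounds below and above are its tangent inequalities at \<open>a \<plusminus> e\<close> and at \<open>s\<close>. The lower bound
with \<open>e = 1\<close> makes \<open>P\<close> coercive; with small \<open>e\<close> it shows that \<open>P\<close> is small only near \<open>a\<close>.\<close>

lemma monotone_primitive:
  fixes k :: "real \<Rightarrow> real"
  assumes cont: "continuous_on UNIV k" and mono: "mono k"
  obtains P where "\<And>s. (P has_real_derivative k s - k a) (at s)" "\<And>s. 0 \<le> P s"
    "\<And>s e. e \<ge> 0 \<Longrightarrow> (\<bar>s - a\<bar> - e) * min (k (a + e) - k a) (k a - k (a - e)) \<le> P s"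
    "\<And>s. P s \<le> \<bar>s - a\<bar> * \<bar>k s - k a\<bar>"
proof -
  have "\<exists>F. \<forall>x::real. (-\<infinity>::ereal) < x \<longrightarrow> x < \<infinity> \<longrightarrow> (F has_vector_derivative k x - k a) (at x)"
    by (rule einterval_antiderivative)
       (use cont in \<open>auto simp: continuous_on_eq_continuous_at intro!: continuous_intros\<close>)
  then obtain F where F: "\<And>x. (F has_real_derivative k x - k a) (at x)"
    by (auto simp: has_real_derivative_iff_has_vector_derivative)
  have conv: "convex_on UNIV F"
    by (rule convex_on_realI[OF _ F]) (use mono in \<open>auto simp: mono_def\<close>)
  have tan: "F y \<ge> F x + (k x - k a) * (y - x)" for x y
    using convex_on_imp_above_tangent[OF conv, of x y "k x - k a"] F[of x] by simp
  define P where "P s = F s - F a" for s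
  have low: "0 \<le> P s" for s using tan[of a s] by (simp add: P_def)
  show ?thesis
  proof (rule that[of P])
    show "(P has_real_derivative k s - k a) (at s)" for s
      unfolding P_def[abs_def] using F[of s] by (auto intro!: derivative_eq_intros)
    show "P s \<le> \<bar>s - a\<bar> * \<bar>k s - k a\<bar>" for s
    proof -
      have "P s \<le> (s - a) * (k s - k a)" using tan[of s a] by (simp add: P_def algebra_simps)
      also have "\<dots> \<le> \<bar>s - a\<bar> * \<bar>k s - k a\<bar>" by (metis abs_ge_self abs_mult)
      finally show ?thesis .
    qed
    show "(\<bar>s - a\<bar> - e) * min (k (a + e) - k a) (k a - k (a - e)) \<le> P s" (is "_ * ?m \<le> _") 
      if e: "e \<ge> 0" for s e
    proof -
      have m0: "0 \<le> ?m" using mono e by (auto simp: mono_def)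
      consider "s \<ge> a + e" | "s \<le> a - e" | "\<bar>s - a\<bar> \<le> e" by linarith
      then show ?thesis
      proof cases
        case 1
        then have "(\<bar>s - a\<bar> - e) * ?m \<le> (s - a - e) * (k (a + e) - k a)"
          using e m0 by (intro mult_mono) auto
        also have "\<dots> \<le> P s"
          using tan[of "a + e" s] low[of "a + e"] by (simp add: P_def algebra_simps)
        finally show ?thesis .
      next
        case 2
        then have "(\<bar>s - a\<bar> - e) * ?m \<le> (a - e - s) * (k a - k (a - e))"
          using e m0 by (intro mult_mono) auto
        also have "\<dots> \<le> P s"
          using tan[of "a - e" s] low[of "a - e"] by (simp add: P_def algebra_simps)
        finally show ?thesis .
      next
        case 3
        then have "(\<bar>s - a\<bar> - e) * ?m \<le> 0" using m0 by (intro mult_nonpos_nonneg) auto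
        then show ?thesis using low[of s] by linarith
      qed
    qed
  qed (rule low)
qed

text \<open>The sum of the one-dimensional primitives. Its derivative along a curve is the velocity paired with
\<open>coordwise k (u t) - coordwise k A\<close>: the reparametrisation by \<open>k\<close>, which distorts the geometry of
the flow, is absorbed exactly.\<close>

lemma coordwise_lyapunov:
  fixes k :: "'a::euclidean_space \<Rightarrow> real \<Rightarrow> real"
  assumes cont: "\<And>b. b \<in> Basis \<Longrightarrow> continuous_on UNIV (k b)"
    and mono: "\<And>b. b \<in> Basis \<Longrightarrow> mono (k b)"
  obtains H where
    "\<And>(u :: real \<Rightarrow> 'a) v t T. (u has_vector_derivative v) (at t within T) \<Longrightarrow>
       ((\<lambda>t. H (u t)) has_real_derivative v \<bullet> (coordwise k (u t) - coordwise k A)) (at t within T)"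
    "\<And>u. 0 \<le> H u"
    "\<And>u b e. b \<in> Basis \<Longrightarrow> e \<ge> 0 \<Longrightarrow> (\<bar>u \<bullet> b - A \<bullet> b\<bar> - e) *
       min (k b (A \<bullet> b + e) - k b (A \<bullet> b)) (k b (A \<bullet> b) - k b (A \<bullet> b - e)) \<le> H u"
    "\<And>u. H u \<le> (\<Sum>b\<in>Basis. \<bar>u \<bullet> b - A \<bullet> b\<bar> * \<bar>k b (u \<bullet> b) - k b (A \<bullet> b)\<bar>)"
proof -
  have "\<forall>b\<in>Basis. \<exists>P. (\<forall>s. (P has_real_derivative k b s - k b (A \<bullet> b)) (at s)) \<and> (\<forall>s. 0 \<le> P s) \<and>
    (\<forall>s e. e \<ge> 0 \<longrightarrow> (\<bar>s - A \<bullet> b\<bar> - e) * min (k b (A \<bullet> b + e) - k b (A \<bullet> b)) (k b (A \<bullet> b) - k b (A \<bullet> b - e)) \<le> P s) \<and>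
    (\<forall>s. P s \<le> \<bar>s - A \<bullet> b\<bar> * \<bar>k b s - k b (A \<bullet> b)\<bar>)"
    by (meson monotone_primitive[OF cont mono])
  then obtain P where P: "\<And>b s. b \<in> Basis \<Longrightarrow> (P b has_real_derivative k b s - k b (A \<bullet> b)) (at s)"
    "\<And>b s. b \<in> Basis \<Longrightarrow> 0 \<le> P b s"
    "\<And>b s e. b \<in> Basis \<Longrightarrow> e \<ge> 0 \<Longrightarrow> (\<bar>s - A \<bullet> b\<bar> - e) *
       min (k b (A \<bullet> b + e) - k b (A \<bullet> b)) (k b (A \<bullet> b) - k b (A \<bullet> b - e)) \<le> P b s"
    "\<And>b s. b \<in> Basis \<Longrightarrow> P b s \<le> \<bar>s - A \<bullet> b\<bar> * \<bar>k b s - k b (A \<bullet> b)\<bar>"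
    by metis
  define H where "H u = (\<Sum>b\<in>Basis. P b (u \<bullet> b))" for u
  have single: "P b (u \<bullet> b) \<le> H u" if "b \<in> Basis" for b u
    unfolding H_def using that P(2) by (intro member_le_sum) auto
  show ?thesis
  proof (rule that[of H])
    fix u :: "real \<Rightarrow> 'a" and v t T assume u: "(u has_vector_derivative v) (at t within T)"
    have "((\<lambda>t. P b (u t \<bullet> b)) has_real_derivative (k b (u t \<bullet> b) - k b (A \<bullet> b)) * (v \<bullet> b)) (at t within T)"
      if b: "b \<in> Basis" for b
    proof -
      have "((\<lambda>t. u t \<bullet> b) has_real_derivative v \<bullet> b) (at t within T)"
        using bounded_linear.has_vector_derivative[OF bounded_linear_inner_left u]
        by (simp add: has_real_derivative_iff_has_vector_derivative)
      then show ?thesis by (rule DERIV_chain2[OF P(1)[OF b]])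
    qed
    then have "((\<lambda>t. H (u t)) has_real_derivative
        (\<Sum>b\<in>Basis. (k b (u t \<bullet> b) - k b (A \<bullet> b)) * (v \<bullet> b))) (at t within T)"
      unfolding H_def by (intro DERIV_sum) auto
    also have "(\<Sum>b\<in>Basis. (k b (u t \<bullet> b) - k b (A \<bullet> b)) * (v \<bullet> b)) =
        v \<bullet> (coordwise k (u t) - coordwise k A)"
      by (subst euclidean_inner) (simp add: inner_diff_left coordwise_inner mult.commute cong: sum.cong)
    finally show "((\<lambda>t. H (u t)) has_real_derivative
        v \<bullet> (coordwise k (u t) - coordwise k A)) (at t within T)" .
  next
    show "0 \<le> H u" for u unfolding H_def by (intro sum_nonneg P)
    show "(\<bar>u \<bullet> b - A \<bullet> b\<bar> - e) *
       min (k b (A \<bullet> b + e) - k b (A \<bullet> b)) (k b (A \<bullet> b) - k b (A \<bullet> b - e)) \<le> H u"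
      if "b \<in> Basis" "e \<ge> 0" for u b e
      using P(3)[OF that, of "u \<bullet> b"] single[OF that(1), of u] by linarith
    show "H u \<le> (\<Sum>b\<in>Basis. \<bar>u \<bullet> b - A \<bullet> b\<bar> * \<bar>k b (u \<bullet> b) - k b (A \<bullet> b)\<bar>)" for u
      unfolding H_def by (intro sum_mono P)
  qed
qed

text \<open>Monotone decrease of the Lyapunov function, stated without mentioning that function. The bound
involves \<open>k\<close> at the points \<open>u s \<bullet> b\<close>, \<open>A \<bullet> b\<close> and \<open>A \<bullet> b \<plusminus> e\<close> only, so modifying \<open>k\<close> elsewhere
does not change it. Weak monotonicity suits the existence proof, which applies the estimate to a
truncated \<open>k\<close> that is constant far away.\<close>

lemma stability_estimate:
  fixes k :: "'a::euclidean_space \<Rightarrow> real \<Rightarrow> real"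
  assumes cont: "\<And>b. b \<in> Basis \<Longrightarrow> continuous_on UNIV (k b)"
    and mono: "\<And>b. b \<in> Basis \<Longrightarrow> mono (k b)"
    and A: "\<And>w. J w \<bullet> (w - coordwise k A) \<le> 0"
    and u: "\<And>t. t \<ge> 0 \<Longrightarrow> (u has_vector_derivative J (coordwise k (u t))) (at t within {0..})"
    and st: "0 \<le> s" "s \<le> t" and b: "b \<in> Basis" "e \<ge> 0"
  shows "(\<bar>u t \<bullet> b - A \<bullet> b\<bar> - e) *
       min (k b (A \<bullet> b + e) - k b (A \<bullet> b)) (k b (A \<bullet> b) - k b (A \<bullet> b - e)) \<le>
     (\<Sum>b\<in>Basis. \<bar>u s \<bullet> b - A \<bullet> b\<bar> * \<bar>k b (u s \<bullet> b) - k b (A \<bullet> b)\<bar>)"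
proof (rule coordwise_lyapunov[where k = k and A = A, OF cont mono])
  fix H
  assume H: "\<And>(u :: real \<Rightarrow> 'a) v t T. (u has_vector_derivative v) (at t within T) \<Longrightarrow>
       ((\<lambda>t. H (u t)) has_real_derivative v \<bullet> (coordwise k (u t) - coordwise k A)) (at t within T)"
    "\<And>u. 0 \<le> H u"
    "\<And>u b e. b \<in> Basis \<Longrightarrow> e \<ge> 0 \<Longrightarrow> (\<bar>u \<bullet> b - A \<bullet> b\<bar> - e) *
       min (k b (A \<bullet> b + e) - k b (A \<bullet> b)) (k b (A \<bullet> b) - k b (A \<bullet> b - e)) \<le> H u"
    "\<And>u. H u \<le> (\<Sum>b\<in>Basis. \<bar>u \<bullet> b - A \<bullet> b\<bar> * \<bar>k b (u \<bullet> b) - k b (A \<bullet> b)\<bar>)"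
  have "H (u t) \<le> H (u s)"
    by (rule nonincreasing_on_half_line[OF H(1)[OF u] A st])
  then show ?thesis using H(3)[OF b, of "u t"] H(4)[of "u s"] by linarith
qed

text \<open>The flow \<open>u' = J (\<kappa> u)\<close> with \<open>\<kappa>\<close> increasing in each coordinate. For \<open>\<kappa> = id\<close> this is the flow of
the field \<open>J\<close>; a general \<open>\<kappa>\<close> lets \<open>J\<close> see each coordinate through an increasing profile.\<close>

locale monotone_flow =
  fixes k :: "'a::euclidean_space \<Rightarrow> real \<Rightarrow> real" and J :: "'a \<Rightarrow> 'a"
  assumes strict_mono_k: "\<And>b. b \<in> Basis \<Longrightarrow> strict_mono (k b)"
    and lipschitz_k: "\<And>b r. b \<in> Basis \<Longrightarrow> \<exists>K. K-lipschitz_on {-r..r} (k b)"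
    and lipschitz_J: "\<And>r. \<exists>K. K-lipschitz_on (cball 0 r) J"
begin

abbreviation \<kappa> :: "'a \<Rightarrow> 'a" where "\<kappa> \<equiv> coordwise k"

text \<open>The field \<open>J\<close> never points away from \<open>\<kappa> A\<close>. By \<open>coordwise_lyapunov\<close> this makes the
Lyapunov function centred at \<open>A\<close> nonincreasing along solutions.\<close>

definition attracting :: "'a \<Rightarrow> bool" where
  "attracting A \<longleftrightarrow> (\<forall>w. J w \<bullet> (w - \<kappa> A) \<le> 0)"

definition solution :: "(real \<Rightarrow> 'a) \<Rightarrow> bool" where
  "solution u \<longleftrightarrow> (\<forall>t\<ge>0. (u has_vector_derivative J (\<kappa> (u t))) (at t within {0..}))"

lemma mono_k: "b \<in> Basis \<Longrightarrow> mono (k b)"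
  by (simp add: strict_mono_k strict_mono_mono)

lemma continuous_k: "b \<in> Basis \<Longrightarrow> continuous_on UNIV (k b)"
proof -
  assume b: "b \<in> Basis"
  have "isCont (k b) s" for s
  proof -
    obtain K where "K-lipschitz_on {-(\<bar>s\<bar> + 1)..\<bar>s\<bar> + 1} (k b)" using lipschitz_k[OF b] by blast
    then have "continuous_on {-(\<bar>s\<bar> + 1)..\<bar>s\<bar> + 1} (k b)" by (rule lipschitz_on_continuous_on)
    then show ?thesis by (rule continuous_on_interior) auto
  qed
  then show ?thesis by (simp add: continuous_on_eq_continuous_at)
qed

lemma continuous_J: "continuous_on UNIV J"
proof -
  have "isCont J w" for w
  proof -
    obtain K where "K-lipschitz_on (cball 0 (norm w + 1)) J" using lipschitz_J by blast
    then have "continuous_on (cball 0 (norm w + 1)) J" by (rule lipschitz_on_continuous_on)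
    then show ?thesis by (rule continuous_on_interior) auto
  qed
  then show ?thesis by (simp add: continuous_on_eq_continuous_at)
qed

lemma continuous_\<kappa>: "continuous_on UNIV \<kappa>"
  unfolding coordwise_def[abs_def]
  by (intro continuous_intros continuous_on_compose2[OF continuous_k]) auto

lemma gap_pos:
  assumes "b \<in> Basis" "e > 0"
  shows "0 < min (k b (a + e) - k b a) (k b a - k b (a - e))"
  using strict_mono_k[OF assms(1)] assms(2) by (auto simp: strict_mono_def)

text \<open>The stability estimate confines every solution to an explicit box. Truncating each \<open>k b\<close> outside
this box gives a bounded, globally Lipschitz field. Its solution satisfies the same estimate, because
the truncation leaves the points that enter the estimate alone; so it never feels the truncation.\<close>

lemma solution_exists:
  assumes A: "attracting A"
  obtains u where "solution u" "u 0 = u0"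
proof -
  define c where "c = (\<Sum>b\<in>Basis. \<bar>u0 \<bullet> b - A \<bullet> b\<bar> * \<bar>k b (u0 \<bullet> b) - k b (A \<bullet> b)\<bar>)"
  define m where "m b = min (k b (A \<bullet> b + 1) - k b (A \<bullet> b)) (k b (A \<bullet> b) - k b (A \<bullet> b - 1))" for b
  have m: "m b > 0" if "b \<in> Basis" for b unfolding m_def by (rule gap_pos[OF that]) simp
  have c0: "c \<ge> 0" unfolding c_def by (intro sum_nonneg) auto
  \<comment> \<open>a box around \<open>0\<close> that contains \<open>u0\<close>, the points \<open>A \<bullet> b \<plusminus> 1\<close>, and all points the stability estimate permits\<close>
  define \<rho> where "\<rho> = (\<Sum>b\<in>Basis. \<bar>A \<bullet> b\<bar> + 1 + \<bar>u0 \<bullet> b\<bar> + c / m b)"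
  have \<rho>: "\<bar>A \<bullet> b\<bar> + 1 + \<bar>u0 \<bullet> b\<bar> + c / m b \<le> \<rho>" if "b \<in> Basis" for b
    unfolding \<rho>_def using that m c0 by (intro member_le_sum) (auto intro!: add_nonneg_nonneg simp: less_imp_le)
  have \<rho>': "\<bar>A \<bullet> b\<bar> + 1 \<le> \<rho>" "\<bar>u0 \<bullet> b\<bar> \<le> \<rho>" "\<bar>A \<bullet> b\<bar> + 1 + c / m b \<le> \<rho>" if "b \<in> Basis" for b
    using \<rho>[OF that] m[OF that] c0 divide_nonneg_pos[of c "m b"] by linarith+
  obtain b0 :: 'a where "b0 \<in> Basis" using nonempty_Basis by blast
  then have \<rho>0: "\<rho> \<ge> 0" using \<rho>'(1) abs_ge_zero[of "A \<bullet> b0"] by force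
  define cl where "cl s = max (- \<rho>) (min \<rho> s)" for s
  have cl: "cl s \<in> {-\<rho>..\<rho>}" "\<bar>s\<bar> \<le> \<rho> \<Longrightarrow> cl s = s" "\<bar>cl s - cl t\<bar> \<le> \<bar>s - t\<bar>" "s \<le> t \<Longrightarrow> cl s \<le> cl t" for s t
    using \<rho>0 unfolding cl_def by auto
  define k' where "k' b s = k b (cl s)" for b s
  have k'eq: "k' b s = k b s" if "\<bar>s\<bar> \<le> \<rho>" for b s using cl(2)[OF that] by (simp add: k'_def)
  have mono': "mono (k' b)" if "b \<in> Basis" for b
    using mono_k[OF that] cl(4) by (auto simp: mono_def k'_def)
  obtain K where K: "\<And>b. b \<in> Basis \<Longrightarrow> (K b)-lipschitz_on {-\<rho>..\<rho>} (k b)"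
    using lipschitz_k[of _ \<rho>] by metis
  have K0: "K b \<ge> 0" if "b \<in> Basis" for b using K[OF that] by (rule lipschitz_on_nonneg)
  have lip': "\<bar>k' b s - k' b t\<bar> \<le> K b * \<bar>s - t\<bar>" if "b \<in> Basis" for b s t
  proof -
    have "\<bar>k' b s - k' b t\<bar> \<le> K b * \<bar>cl s - cl t\<bar>"
      using lipschitz_onD[OF K[OF that] cl(1) cl(1)] by (simp add: k'_def dist_real_def)
    also have "\<dots> \<le> K b * \<bar>s - t\<bar>" using cl(3) K0[OF that] by (intro mult_left_mono)
    finally show ?thesis .
  qed
  have cont': "continuous_on UNIV (k' b)" if "b \<in> Basis" for b
    unfolding k'_def[abs_def] cl_def
    by (intro continuous_on_compose2[OF continuous_k[OF that]] continuous_intros) auto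
  define R where "R = (\<Sum>b\<in>Basis. \<bar>k b \<rho>\<bar> + \<bar>k b (- \<rho>)\<bar>)"
  have \<kappa>'R: "coordwise k' w \<in> cball 0 R" for w
  proof -
    have "norm (coordwise k' w) \<le> (\<Sum>b\<in>Basis. \<bar>k' b (w \<bullet> b)\<bar>)"
      using norm_le_l1[of "coordwise k' w"] by (simp add: coordwise_inner cong: sum.cong)
    also have "\<dots> \<le> R"
      unfolding R_def
    proof (rule sum_mono)
      fix b :: 'a assume b: "b \<in> Basis"
      have "k b (- \<rho>) \<le> k' b (w \<bullet> b)" "k' b (w \<bullet> b) \<le> k b \<rho>"
        using mono_k[OF b] cl(1)[of "w \<bullet> b"] by (auto simp: k'_def mono_def)
      then show "\<bar>k' b (w \<bullet> b)\<bar> \<le> \<bar>k b \<rho>\<bar> + \<bar>k b (- \<rho>)\<bar>" by linarith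
    qed
    finally show ?thesis by simp
  qed
  obtain KJ where KJ: "KJ-lipschitz_on (cball 0 R) J" using lipschitz_J by blast
  have KJ0: "KJ \<ge> 0" using KJ by (rule lipschitz_on_nonneg)
  have "(KJ * (\<Sum>b\<in>Basis. K b))-lipschitz_on UNIV (\<lambda>w. J (coordwise k' w))"
  proof (rule lipschitz_onI)
    fix v w :: 'a
    have "dist (J (coordwise k' v)) (J (coordwise k' w)) \<le> KJ * norm (coordwise k' v - coordwise k' w)"
      using lipschitz_onD[OF KJ \<kappa>'R \<kappa>'R] by (simp add: dist_norm)
    also have "\<dots> \<le> KJ * (\<Sum>b\<in>Basis. K b * norm (v - w))"
    proof (rule mult_left_mono[OF _ KJ0])
      have "norm (coordwise k' v - coordwise k' w) \<le> (\<Sum>b\<in>Basis. \<bar>k' b (v \<bullet> b) - k' b (w \<bullet> b)\<bar>)"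
        using norm_le_l1[of "coordwise k' v - coordwise k' w"]
        by (simp add: coordwise_inner inner_diff_left cong: sum.cong)
      also have "\<dots> \<le> (\<Sum>b\<in>Basis. K b * norm (v - w))"
      proof (rule sum_mono)
        fix b :: 'a assume b: "b \<in> Basis"
        have "\<bar>k' b (v \<bullet> b) - k' b (w \<bullet> b)\<bar> \<le> K b * \<bar>v \<bullet> b - w \<bullet> b\<bar>" by (rule lip'[OF b])
        also have "\<dots> \<le> K b * norm (v - w)"
          using Basis_le_norm[OF b, of "v - w"] K0[OF b]
          by (intro mult_left_mono) (auto simp: inner_diff_left)
        finally show "\<bar>k' b (v \<bullet> b) - k' b (w \<bullet> b)\<bar> \<le> K b * norm (v - w)" .
      qed
      finally show "norm (coordwise k' v - coordwise k' w) \<le> (\<Sum>b\<in>Basis. K b * norm (v - w))" .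
    qed
    finally show "dist (J (coordwise k' v)) (J (coordwise k' w)) \<le> KJ * (\<Sum>b\<in>Basis. K b) * dist v w"
      by (simp add: dist_norm sum_distrib_right mult.assoc)
  qed (use KJ0 K0 in \<open>auto intro!: mult_nonneg_nonneg sum_nonneg\<close>)
  moreover have "norm (J (coordwise k' w)) \<le> norm (J 0) + KJ * R" for w
  proof -
    have R0: "0 \<in> cball (0::'a) R" unfolding R_def by (auto intro!: sum_nonneg)
    have "norm (J (coordwise k' w) - J 0) \<le> KJ * norm (coordwise k' w - 0)"
      by (rule lipschitz_on_normD[OF KJ \<kappa>'R R0])
    also have "\<dots> \<le> KJ * R" using \<kappa>'R[of w] KJ0 by (intro mult_left_mono) auto
    finally show ?thesis using norm_triangle_sub[of "J (coordwise k' w)" "J 0"] by linarith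
  qed
  ultimately obtain u where u0: "u 0 = u0" and u:
    "\<And>t. t \<ge> 0 \<Longrightarrow> (u has_vector_derivative J (coordwise k' (u t))) (at t within {0..})"
    by (rule global_solution_of_bounded_lipschitz) blast
  have "coordwise k' A = \<kappa> A"
    unfolding coordwise_def
    by (intro sum.cong refl arg_cong[where f = "\<lambda>s. s *\<^sub>R _"] k'eq) (use \<rho>'(1) in force)
  then have A': "J w \<bullet> (w - coordwise k' A) \<le> 0" for w
    using A by (simp add: attracting_def)
  have "coordwise k' (u t) = \<kappa> (u t)" if t: "t \<ge> 0" for t
    unfolding coordwise_def
  proof (intro sum.cong refl arg_cong[where f = "\<lambda>s. s *\<^sub>R _"] k'eq)
    fix b :: 'a assume b: "b \<in> Basis"
    have "(\<bar>u t \<bullet> b - A \<bullet> b\<bar> - 1) *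
       min (k' b (A \<bullet> b + 1) - k' b (A \<bullet> b)) (k' b (A \<bullet> b) - k' b (A \<bullet> b - 1)) \<le>
       (\<Sum>b\<in>Basis. \<bar>u 0 \<bullet> b - A \<bullet> b\<bar> * \<bar>k' b (u 0 \<bullet> b) - k' b (A \<bullet> b)\<bar>)"
      using stability_estimate[of k' J A u 0 t b 1] cont' mono' A' u t b by auto
    also have "\<dots> = c"
      unfolding c_def u0
      by (intro sum.cong refl arg_cong2[where f = "\<lambda>x y. _ * \<bar>x - y\<bar>"] k'eq) (use \<rho>'(1,2) in force)+
    also have "min (k' b (A \<bullet> b + 1) - k' b (A \<bullet> b)) (k' b (A \<bullet> b) - k' b (A \<bullet> b - 1)) = m b"
      unfolding m_def using \<rho>'(1)[OF b] by (subst (1 2 3 4) k'eq) auto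
    finally have "\<bar>u t \<bullet> b - A \<bullet> b\<bar> \<le> 1 + c / m b" using m[OF b] by (simp add: field_simps)
    then show "\<bar>u t \<bullet> b\<bar> \<le> \<rho>" using \<rho>'(3)[OF b] by linarith
  qed
  then have "solution u" unfolding solution_def using u by auto
  then show ?thesis using that u0 by blast
qed

context
  fixes A u
  assumes A: "attracting A" and u: "solution u"
begin

lemma derivative_u: "t \<ge> 0 \<Longrightarrow> (u has_vector_derivative J (\<kappa> (u t))) (at t within {0..})"
  using u by (simp add: solution_def)

lemma solution_stability:
  assumes "0 \<le> s" "s \<le> t" "b \<in> Basis" "e \<ge> 0"
  shows "(\<bar>u t \<bullet> b - A \<bullet> b\<bar> - e) *
       min (k b (A \<bullet> b + e) - k b (A \<bullet> b)) (k b (A \<bullet> b) - k b (A \<bullet> b - e)) \<le>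
     (\<Sum>b\<in>Basis. \<bar>u s \<bullet> b - A \<bullet> b\<bar> * \<bar>k b (u s \<bullet> b) - k b (A \<bullet> b)\<bar>)"
  by (rule stability_estimate[OF continuous_k mono_k _ derivative_u assms])
     (use A in \<open>auto simp: attracting_def\<close>)

lemma bounded_solution: "bounded (u ` {0..})"
proof -
  define c where "c = (\<Sum>b\<in>Basis. \<bar>u 0 \<bullet> b - A \<bullet> b\<bar> * \<bar>k b (u 0 \<bullet> b) - k b (A \<bullet> b)\<bar>)"
  define m where "m b = min (k b (A \<bullet> b + 1) - k b (A \<bullet> b)) (k b (A \<bullet> b) - k b (A \<bullet> b - 1))" for b
  have m: "m b > 0" if "b \<in> Basis" for b unfolding m_def by (rule gap_pos[OF that]) simp
  have "norm (u t) \<le> (\<Sum>b\<in>Basis. \<bar>A \<bullet> b\<bar> + 1 + c / m b)" if "t \<ge> 0" for t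
  proof (rule order_trans[OF norm_le_l1], rule sum_mono)
    fix b :: 'a assume b: "b \<in> Basis"
    have "(\<bar>u t \<bullet> b - A \<bullet> b\<bar> - 1) * m b \<le> c"
      unfolding m_def c_def by (rule solution_stability) (use that b in auto)
    then have "\<bar>u t \<bullet> b - A \<bullet> b\<bar> \<le> 1 + c / m b" using m[OF b] by (simp add: field_simps)
    then show "\<bar>u t \<bullet> b\<bar> \<le> \<bar>A \<bullet> b\<bar> + 1 + c / m b" by linarith
  qed
  then show ?thesis unfolding bounded_iff by auto
qed

text \<open>A bounded solution has bounded speed. This supplies the uniform continuity needed for Barbalat's
lemma.\<close>

lemma uniformly_continuous_along_solution:
  fixes Q :: "'a \<Rightarrow> real"
  assumes Q: "continuous_on UNIV Q"
  shows "uniformly_continuous_on {0..} (\<lambda>t. Q (u t))"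
proof -
  let ?C = "closure (u ` {0..})"
  have comp: "compact ?C" using bounded_solution by (simp add: compact_closure)
  have mem: "u t \<in> ?C" if "t \<ge> 0" for t using that closure_subset by fastforce
  have "continuous_on UNIV (\<lambda>w. J (\<kappa> w))"
    by (rule continuous_on_compose2[OF continuous_J continuous_\<kappa>]) auto
  then have "bounded ((\<lambda>w. J (\<kappa> w)) ` ?C)"
    by (intro compact_imp_bounded compact_continuous_image comp) (auto intro: continuous_on_subset)
  then obtain B where B: "B > 0" "\<And>w. w \<in> ?C \<Longrightarrow> norm (J (\<kappa> w)) \<le> B"
    unfolding bounded_pos by auto
  have "B-lipschitz_on {0..} u"
  proof (rule lipschitz_onI)
    fix s t :: real assume st: "s \<in> {0..}" "t \<in> {0..}"
    have "onorm (\<lambda>h. h *\<^sub>R J (\<kappa> (u r))) \<le> B" if "r \<in> {0..}" for r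
    proof (rule onorm_le)
      show "norm (h *\<^sub>R J (\<kappa> (u r))) \<le> B * norm h" for h
        using mult_right_mono[OF B(2)[OF mem], of r "\<bar>h\<bar>"] that by (simp add: mult.commute)
    qed
    then show "dist (u s) (u t) \<le> B * dist s t"
      unfolding dist_norm
      using differentiable_bound[of "{0..}" u "\<lambda>r h. h *\<^sub>R J (\<kappa> (u r))" B s t]
        derivative_u st by (auto simp: has_vector_derivative_def)
  qed (use B in auto)
  then have "uniformly_continuous_on {0..} u" by (rule lipschitz_on_uniformly_continuous)
  moreover have "uniformly_continuous_on (u ` {0..}) Q"
    using compact_uniformly_continuous[OF continuous_on_subset[OF Q] comp] closure_subset[of "u ` {0..}"]
    unfolding uniformly_continuous_on_def by (meson subsetD subset_UNIV)
  ultimately show ?thesis by (rule uniformly_continuous_on_compose)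
qed

text \<open>The Lyapunov function converges along the solution, being nonincreasing and nonnegative; so
Barbalat's lemma applies to its derivative.\<close>

lemma dissipation_vanishes: "((\<lambda>t. J (\<kappa> (u t)) \<bullet> (\<kappa> (u t) - \<kappa> A)) \<longlongrightarrow> 0) at_top"
proof (rule coordwise_lyapunov[where k = k and A = A, OF continuous_k mono_k])
  fix H
  assume H: "\<And>(u :: real \<Rightarrow> 'a) v t T. (u has_vector_derivative v) (at t within T) \<Longrightarrow>
       ((\<lambda>t. H (u t)) has_real_derivative v \<bullet> (\<kappa> (u t) - \<kappa> A)) (at t within T)"
    "\<And>u. 0 \<le> H u"
  note dH = H(1)[OF derivative_u]
  have neg: "J w \<bullet> (w - \<kappa> A) \<le> 0" for w using A by (simp add: attracting_def)
  have dec: "H (u t) \<le> H (u s)" if "0 \<le> s" "s \<le> t" for s t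
    by (rule nonincreasing_on_half_line[OF dH neg that])
  define l where "l = (INF t\<in>{0..}. H (u t))"
  have bdd: "bdd_below ((\<lambda>t. H (u t)) ` {0..})" by (rule bdd_belowI[of _ 0]) (use H(2) in auto)
  have lim: "((\<lambda>t. H (u t)) \<longlongrightarrow> l) at_top"
  proof (rule tendstoI)
    fix e :: real assume "e > 0"
    then have "\<exists>x\<in>(\<lambda>t. H (u t)) ` {0..}. x < l + e"
      unfolding l_def using bdd by (intro cInf_lessD) auto
    then obtain T where T: "T \<ge> 0" "H (u T) < l + e" by auto
    have "dist (H (u t)) l < e" if "t \<ge> T" for t
    proof -
      have "l \<le> H (u t)" unfolding l_def using bdd that T by (intro cINF_lower) auto
      moreover have "H (u t) < l + e" using dec[OF T(1) that] T(2) by linarith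
      ultimately show ?thesis by (auto simp: dist_real_def)
    qed
    then show "\<forall>\<^sub>F t in at_top. dist (H (u t)) l < e"
      unfolding eventually_at_top_linorder by blast
  qed
  have uc: "uniformly_continuous_on {0..} (\<lambda>t. J (\<kappa> (u t)) \<bullet> (\<kappa> (u t) - \<kappa> A))"
    by (rule uniformly_continuous_along_solution[where Q = "\<lambda>w. J (\<kappa> w) \<bullet> (\<kappa> w - \<kappa> A)"])
       (intro continuous_intros continuous_on_compose2[OF continuous_J continuous_\<kappa>] continuous_\<kappa>, auto)
  show "((\<lambda>t. J (\<kappa> (u t)) \<bullet> (\<kappa> (u t) - \<kappa> A)) \<longlongrightarrow> 0) at_top"
    by (rule barbalat[OF dH uc lim])
qed

lemma component_rate_vanishes:
  assumes b: "b \<in> Basis" and lim: "((\<lambda>t. u t \<bullet> b) \<longlongrightarrow> l) at_top"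
  shows "((\<lambda>t. J (\<kappa> (u t)) \<bullet> b) \<longlongrightarrow> 0) at_top"
proof (rule barbalat[OF _ _ lim])
  show "((\<lambda>t. u t \<bullet> b) has_real_derivative J (\<kappa> (u t)) \<bullet> b) (at t within {0..})" if "t \<ge> 0" for t
    using bounded_linear.has_vector_derivative[OF bounded_linear_inner_left derivative_u[OF that]]
    by (simp add: has_real_derivative_iff_has_vector_derivative)
  show "uniformly_continuous_on {0..} (\<lambda>t. J (\<kappa> (u t)) \<bullet> b)"
    by (rule uniformly_continuous_along_solution[where Q = "\<lambda>w. J (\<kappa> w) \<bullet> b"])
       (intro continuous_intros continuous_on_compose2[OF continuous_J continuous_\<kappa>], auto)
qed

lemma solution_limit_point:
  obtains B T where "filterlim T at_top sequentially" "\<And>n. T n \<ge> (0::real)" "(\<lambda>n. u (T n)) \<longlonglongrightarrow> B"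
proof -
  have "compact (closure (u ` {0..}))" using bounded_solution by (simp add: compact_closure)
  moreover have "\<forall>n. u (real n) \<in> closure (u ` {0..})"
    by (auto intro!: subsetD[OF closure_subset])
  ultimately obtain B r where "strict_mono (r :: nat \<Rightarrow> nat)" "((\<lambda>n. u (real n)) \<circ> r) \<longlonglongrightarrow> B"
    unfolding compact_def by (metis (no_types, lifting))
  then show ?thesis
    by (intro that[of "\<lambda>n. real (r n)" B])
       (auto simp: o_def intro!: filterlim_compose[OF filterlim_real_sequentially] filterlim_subseq)
qed

text \<open>The Lyapunov function centred at \<open>A\<close> becomes arbitrarily small along the sequence \<open>T\<close>, and from
then on it stays small.\<close>

lemma solution_converges_to_attracting_limit_point:
  assumes T: "\<And>n. T n \<ge> (0::real)" "(\<lambda>n. u (T n)) \<longlonglongrightarrow> A"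
  shows "(u \<longlongrightarrow> A) at_top"
proof -
  define U where "U v = (\<Sum>b\<in>Basis. \<bar>v \<bullet> b - A \<bullet> b\<bar> * \<bar>k b (v \<bullet> b) - k b (A \<bullet> b)\<bar>)" for v
  have "continuous_on UNIV U" unfolding U_def[abs_def]
    by (intro continuous_intros continuous_on_compose2[OF continuous_k]) auto
  then have "isCont U A" by (simp add: continuous_on_eq_continuous_at)
  then have U0: "(\<lambda>n. U (u (T n))) \<longlonglongrightarrow> U A" using T(2) by (rule isCont_tendsto_compose)
  have "((\<lambda>t. u t \<bullet> b) \<longlongrightarrow> A \<bullet> b) at_top" if b: "b \<in> Basis" for b
  proof (rule tendstoI)
    fix e :: real assume e: "e > 0"
    define m where "m = min (k b (A \<bullet> b + e / 2) - k b (A \<bullet> b)) (k b (A \<bullet> b) - k b (A \<bullet> b - e / 2))"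
    have m: "m > 0" unfolding m_def by (rule gap_pos[OF b]) (use e in simp)
    have "U A = 0" by (simp add: U_def)
    then have "\<forall>\<^sub>F n in sequentially. U (u (T n)) < m * (e / 2)"
      using order_tendstoD(2)[OF U0, of "m * (e / 2)"] m e by simp
    then obtain n where n: "U (u (T n)) < m * (e / 2)" by (auto simp: eventually_sequentially)
    have "dist (u t \<bullet> b) (A \<bullet> b) < e" if "t \<ge> T n" for t
    proof -
      have "(\<bar>u t \<bullet> b - A \<bullet> b\<bar> - e / 2) * m \<le> U (u (T n))"
        unfolding m_def U_def using T(1) that b e by (intro solution_stability) auto
      also note n
      finally have "\<bar>u t \<bullet> b - A \<bullet> b\<bar> - e / 2 < e / 2" using m by (simp add: mult.commute)
      then show ?thesis by (simp add: dist_real_def)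
    qed
    then show "\<forall>\<^sub>F t in at_top. dist (u t \<bullet> b) (A \<bullet> b) < e"
      unfolding eventually_at_top_linorder by blast
  qed
  then show ?thesis by (subst tendsto_componentwise_iff) auto
qed

end
end

text \<open>A substitute for LaSalle's invariance principle. If \<open>P\<close> vanishes in the limit and its zeros pin the
\<open>b\<close>-coordinate, then this coordinate converges, so by Barbalat's lemma its velocity tends to zero.\<close>

lemma (in monotone_flow) rate_vanishes_at_limit_point:
  assumes A: "attracting A" and u: "solution u" and b: "b \<in> Basis"
    and P: "continuous_on UNIV P" "((\<lambda>t. P (\<kappa> (u t))) \<longlongrightarrow> 0) at_top"
    and P0: "\<And>w. P w = (0::real) \<Longrightarrow> w \<bullet> b = \<kappa> A \<bullet> b"
    and T: "filterlim T at_top sequentially" "(\<lambda>n. u (T n)) \<longlonglongrightarrow> B"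
  shows "J (\<kappa> B) \<bullet> b = 0"
proof -
  have inj: "w \<bullet> b = A \<bullet> b" if "\<kappa> w \<bullet> b = \<kappa> A \<bullet> b" for w
    using that strict_mono_eq[OF strict_mono_k[OF b]] by (simp add: coordwise_inner[OF b])
  have "((\<lambda>t. u t \<bullet> b - A \<bullet> b) \<longlongrightarrow> 0) at_top"
  proof (rule vanishing_along_bounded_curve[where P = "\<lambda>w. P (\<kappa> w)" and Q = "\<lambda>w. w \<bullet> b - A \<bullet> b"])
    show "bounded (u ` {0..})" by (rule bounded_solution[OF A u])
    show "continuous_on UNIV (\<lambda>w. P (\<kappa> w))"
      by (rule continuous_on_compose2[OF P(1) continuous_\<kappa>]) auto
    show "w \<bullet> b - A \<bullet> b = 0" if "P (\<kappa> w) = 0" for w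
      using inj[OF P0[OF that]] by simp
  qed (intro continuous_intros, rule P(2))
  then have "((\<lambda>t. u t \<bullet> b) \<longlongrightarrow> A \<bullet> b) at_top" by (rule LIM_zero_cancel)
  then have "((\<lambda>t. J (\<kappa> (u t)) \<bullet> b) \<longlongrightarrow> 0) at_top"
    by (rule component_rate_vanishes[OF A u b])
  then have 0: "(\<lambda>n. J (\<kappa> (u (T n))) \<bullet> b) \<longlonglongrightarrow> 0"
    by (rule filterlim_compose[OF _ T(1)])
  have "continuous_on UNIV (\<lambda>w. J (\<kappa> w) \<bullet> b)"
    by (intro continuous_intros continuous_on_compose2[OF continuous_J continuous_\<kappa>]) auto
  then have "isCont (\<lambda>w. J (\<kappa> w) \<bullet> b) B" by (simp add: continuous_on_eq_continuous_at)
  then have "(\<lambda>n. J (\<kappa> (u (T n))) \<bullet> b) \<longlonglongrightarrow> J (\<kappa> B) \<bullet> b"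
    using T(2) by (rule isCont_tendsto_compose)
  with 0 show ?thesis by (rule LIMSEQ_unique[symmetric, OF _ _])
qed

section \<open>Strictly convex concave functions\<close>

lemma convex_above_tangent_plane:
  fixes h :: "'a::real_normed_vector \<Rightarrow> real"
  assumes conv: "convex_on UNIV h" and D: "(h has_derivative D) (at x)"
  shows "h x + D (y - x) \<le> h y"
proof -
  define g where "g s = h (x + s *\<^sub>R (y - x))" for s :: real
  have "convex_on UNIV g"
  proof (rule convex_onI)
    fix t s1 s2 :: real assume t: "0 < t" "t < 1"
    have "x + ((1 - t) * s1 + t * s2) *\<^sub>R (y - x) =
        (1 - t) *\<^sub>R (x + s1 *\<^sub>R (y - x)) + t *\<^sub>R (x + s2 *\<^sub>R (y - x))"
      by (simp add: algebra_simps)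
    then show "g ((1 - t) *\<^sub>R s1 + t *\<^sub>R s2) \<le> (1 - t) * g s1 + t * g s2"
      unfolding g_def using convex_onD[OF conv, of t "x + s1 *\<^sub>R (y - x)" "x + s2 *\<^sub>R (y - x)"] t
      by simp
  qed simp
  moreover have "(g has_real_derivative D (y - x)) (at 0)"
  proof -
    have "((\<lambda>s. x + s *\<^sub>R (y - x)) has_derivative (\<lambda>s. s *\<^sub>R (y - x))) (at (0::real))"
      by (auto intro!: derivative_eq_intros)
    moreover have "(h has_derivative D) (at (x + 0 *\<^sub>R (y - x)))" using D by simp
    ultimately have "(g has_derivative (\<lambda>s. D (s *\<^sub>R (y - x)))) (at 0)"
      unfolding g_def[abs_def] by (rule has_derivative_compose)
    then show ?thesis
      unfolding has_field_derivative_def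
      by (rule has_derivative_eq_rhs)
         (simp add: fun_eq_iff linear_scale[OF has_derivative_linear[OF D]] mult.commute)
  qed
  ultimately have "D (y - x) * (1 - 0) \<le> g 1 - g 0"
    by (intro convex_on_imp_above_tangent[of UNIV]) auto
  then show ?thesis by (simp add: g_def)
qed

lemma strictly_convex_unique_minimiser:
  assumes "strictly_convex h" and min: "\<And>x. h p \<le> h x" and eq: "h x = h p"
  shows "x = p"
proof (rule ccontr)
  assume "x \<noteq> p"
  then have "h ((1 - 1/2) *\<^sub>R x + (1/2) *\<^sub>R p) < (1 - 1/2) * h x + (1/2) * h p"
    using assms(1)[unfolded strictly_convex_def, rule_format, of x p "1/2"] by simp
  with min[of "(1 - 1/2) *\<^sub>R x + (1/2) *\<^sub>R p"] eq show False by simp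
qed

definition descent_ascent_field :: "('a::euclidean_space \<times> 'b::euclidean_space \<Rightarrow> real) \<Rightarrow> 'a \<times> 'b \<Rightarrow> 'a \<times> 'b" where
  "descent_ascent_field L w = (- fst (gradient_on UNIV L w), snd (gradient_on UNIV L w))"

context
  fixes L :: "'a::euclidean_space \<times> 'b::euclidean_space \<Rightarrow> real"
  assumes C2: "C2_on UNIV L"
begin

lemma L_has_derivative: "(L has_derivative (\<lambda>h. gradient_on UNIV L w \<bullet> h)) (at w)"
  using gradient_on_has_derivative[OF subspace_UNIV C2, of w] by simp

lemma continuous_L: "continuous_on UNIV L"
  by (intro continuous_at_imp_continuous_on ballI has_derivative_continuous[OF L_has_derivative])

lemma descent_ascent_field_lipschitz: "\<exists>K. K-lipschitz_on (cball 0 r) (descent_ascent_field L)"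
proof -
  obtain K where K: "K-lipschitz_on (cball 0 r) (gradient_on UNIV L)"
    using C2_on_gradient_lipschitz[OF subspace_UNIV C2, of r] by auto
  have iso: "dist (- fst v, snd v) (- fst w, snd w) = dist v w" for v w :: "'a \<times> 'b"
    by (simp add: dist_prod_def dist_minus)
  have "K-lipschitz_on (cball 0 r) (descent_ascent_field L)"
    using K unfolding lipschitz_on_def descent_ascent_field_def iso .
  then show ?thesis by blast
qed

lemma L_has_derivative_fst:
  "((\<lambda>x. L (x, y)) has_derivative (\<lambda>h. fst (gradient_on UNIV L (x, y)) \<bullet> h)) (at x)"
proof -
  have "((\<lambda>x. (x, y)) has_derivative (\<lambda>h. (h, 0))) (at x)"
    by (auto intro!: derivative_eq_intros)
  from has_derivative_compose[OF this L_has_derivative] show ?thesis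
    by (simp add: inner_prod_def)
qed

lemma L_has_derivative_snd:
  "((\<lambda>y. L (x, y)) has_derivative (\<lambda>h. snd (gradient_on UNIV L (x, y)) \<bullet> h)) (at y)"
proof -
  have "((\<lambda>y. (x, y)) has_derivative (\<lambda>h. (0, h))) (at y)"
    by (auto intro!: derivative_eq_intros)
  from has_derivative_compose[OF this L_has_derivative] show ?thesis
    by (simp add: inner_prod_def)
qed

text \<open>The gradient inequalities for the convex and the concave variable, taken at \<open>w\<close> in the direction
of \<open>(p, q)\<close>, add up to the third claim, in which \<open>L w\<close> cancels.\<close>

lemma descent_ascent_monotone:
  assumes cc: "convex_concave L"
  shows convex_part: "L (x, y) + fst (gradient_on UNIV L (x, y)) \<bullet> (x' - x) \<le> L (x', y)"
    and concave_part: "L (x, y') \<le> L (x, y) + snd (gradient_on UNIV L (x, y)) \<bullet> (y' - y)"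
    and dissipation_bound: "descent_ascent_field L w \<bullet> (w - (p, q)) \<le> L (p, snd w) - L (fst w, q)"
proof -
  have conv: "convex_on UNIV (\<lambda>x. L (x, y))" for y using cc by (simp add: convex_concave_def)
  have conc: "convex_on UNIV (\<lambda>y. - L (x, y))" for x
    using cc by (simp add: convex_concave_def concave_on_def)
  show 1: "L (x, y) + fst (gradient_on UNIV L (x, y)) \<bullet> (x' - x) \<le> L (x', y)" for x y x'
    by (rule convex_above_tangent_plane[OF conv L_has_derivative_fst])
  show 2: "L (x, y') \<le> L (x, y) + snd (gradient_on UNIV L (x, y)) \<bullet> (y' - y)" for x y y'
    using convex_above_tangent_plane[OF conc has_derivative_minus[OF L_has_derivative_snd], of x y y']
    by linarith
  show "descent_ascent_field L w \<bullet> (w - (p, q)) \<le> L (p, snd w) - L (fst w, q)"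
    using 1[of "fst w" "snd w" p] 2[of "fst w" q "snd w"]
    by (simp add: descent_ascent_field_def inner_prod_def inner_diff_right)
qed

lemma field_points_towards_equilibrium:
  assumes cc: "convex_concave L" and z: "z \<in> equilibria L"
  shows "descent_ascent_field L w \<bullet> (w - z) \<le> 0"
proof -
  obtain p q where pq: "z = (p, q)" by fastforce
  have "L (p, snd w) \<le> L (p, q)" "L (p, q) \<le> L (fst w, q)"
    using z pq by (auto simp: equilibria_def)
  with dissipation_bound[OF cc, of w p q] show ?thesis by (simp add: pq)
qed

text \<open>At the given equilibrium \<open>(p, q)\<close> the derivative of the Lyapunov function is at most \<open>L (p, y) - L (x, q)\<close> and tends to zero, so
\<open>L (x, q)\<close> and \<open>L (p, y)\<close> both tend to \<open>L (p, q)\<close>. Strictness in one of the variables forces that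
variable to converge to its equilibrium value, and hence its partial gradient to vanish in the limit.
The other variable may keep a limit different from its value at \<open>(p, q)\<close>, but it is optimal
against the first one; so every limit point is an equilibrium. Centring the Lyapunov function at a limit
point upgrades this to convergence.\<close>

lemma saddle_flow_converges:
  assumes flow: "monotone_flow k (descent_ascent_field L)"
    and scc: "strictly_convex_concave L"
    and A: "coordwise k A \<in> equilibria L"
    and u: "monotone_flow.solution k (descent_ascent_field L) u"
  obtains B where "(u \<longlongrightarrow> B) at_top" "coordwise k B \<in> equilibria L"
proof -
  interpret monotone_flow k "descent_ascent_field L" by (rule flow)
  have cc: "convex_concave L" using scc by (simp add: strictly_convex_concave_def)
  note bound = dissipation_bound[OF cc]
  have equil_attracting: "attracting C" if "coordwise k C \<in> equilibria L" for C
    unfolding attracting_def using field_points_towards_equilibrium[OF cc that] by blast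
  obtain p q where pq: "coordwise k A = (p, q)" by fastforce
  have eq: "L (p, y) \<le> L (p, q)" "L (p, q) \<le> L (x, q)" for x y
    using A pq by (auto simp: equilibria_def)
  note attA = equil_attracting[OF A]
  \<comment> \<open>the gaps by which \<open>x\<close> and \<open>y\<close> fail to be optimal against \<open>q\<close> and \<open>p\<close>\<close>
  define P1 where "P1 w = L (fst w, q) - L (p, q)" for w :: "'a \<times> 'b"
  define P2 where "P2 w = L (p, q) - L (p, snd w)" for w :: "'a \<times> 'b"
  have P_cont: "continuous_on UNIV P1" "continuous_on UNIV P2"
    unfolding P1_def[abs_def] P2_def[abs_def]
    by (intro continuous_intros continuous_on_compose2[OF continuous_L]; auto)+
  define d where "d t = descent_ascent_field L (coordwise k (u t)) \<bullet> (coordwise k (u t) - coordwise k A)" for t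
  have d: "((\<lambda>t. - d t) \<longlongrightarrow> 0) at_top"
    using tendsto_minus[OF dissipation_vanishes[OF attA u]] by (simp add: d_def)
  have P_bounds: "0 \<le> P1 w" "0 \<le> P2 w" for w using eq by (auto simp: P1_def P2_def)
  have P_le: "P1 (coordwise k (u t)) \<le> - d t" "P2 (coordwise k (u t)) \<le> - d t" for t
    using bound[of "coordwise k (u t)" p q] P_bounds[of "coordwise k (u t)"]
    by (simp_all add: P1_def P2_def d_def pq)
  have P1_lim: "((\<lambda>t. P1 (coordwise k (u t))) \<longlongrightarrow> 0) at_top"
    by (rule tendsto_sandwich[OF _ _ tendsto_const d])
       (simp_all add: P_bounds P_le)
  have P2_lim: "((\<lambda>t. P2 (coordwise k (u t))) \<longlongrightarrow> 0) at_top"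
    by (rule tendsto_sandwich[OF _ _ tendsto_const d])
       (simp_all add: P_bounds P_le)
  obtain B T where T: "filterlim T at_top sequentially" "\<And>n. T n \<ge> (0::real)" "(\<lambda>n. u (T n)) \<longlonglongrightarrow> B"
    using solution_limit_point[OF attA u] by blast
  obtain x' y' where B: "coordwise k B = (x', y')" by fastforce
  have limit_zero: "P (coordwise k B) = 0"
    if "continuous_on UNIV P" "((\<lambda>t. P (coordwise k (u t))) \<longlongrightarrow> 0) at_top" for P :: "'a \<times> 'b \<Rightarrow> real"
  proof -
    have "continuous_on UNIV (\<lambda>w. P (coordwise k w))"
      by (rule continuous_on_compose2[OF that(1) continuous_\<kappa>]) auto
    then have "isCont (\<lambda>w. P (coordwise k w)) B"
      using continuous_on_eq_continuous_at[OF open_UNIV] by blast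
    then have "(\<lambda>n. P (coordwise k (u (T n)))) \<longlonglongrightarrow> P (coordwise k B)"
      using T(3) by (rule isCont_tendsto_compose)
    moreover have "(\<lambda>n. P (coordwise k (u (T n)))) \<longlonglongrightarrow> 0"
      by (rule filterlim_compose[OF that(2) T(1)])
    ultimately show ?thesis by (rule LIMSEQ_unique)
  qed
  have Lx': "L (x', q) = L (p, q)"
    using limit_zero[OF P_cont(1) P1_lim] by (simp add: P1_def B)
  have Ly': "L (p, y') = L (p, q)"
    using limit_zero[OF P_cont(2) P2_lim] by (simp add: P2_def B)
  have "(x', y') \<in> equilibria L"
    using scc[unfolded strictly_convex_concave_def, THEN conjunct2, rule_format, of q p]
  proof
    assume sc: "strictly_convex (\<lambda>x. L (x, q))"
    have uniq: "x = p" if "L (x, q) = L (p, q)" for x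
      using strictly_convex_unique_minimiser[OF sc eq(2) that] .
    have vanish: "fst (descent_ascent_field L (x', y')) \<bullet> b = 0" if b: "b \<in> Basis" for b
    proof -
      have "descent_ascent_field L (coordwise k B) \<bullet> (b, 0) = 0"
      proof (rule rate_vanishes_at_limit_point[OF attA u _ P_cont(1) P1_lim _ T(1,3)])
        show "(b, 0) \<in> Basis" using b by (simp add: Basis_prod_def)
        show "w \<bullet> (b, 0) = coordwise k A \<bullet> (b, 0)" if "P1 w = 0" for w
          using uniq[of "fst w"] that by (simp add: P1_def pq inner_prod_def)
      qed
      then show ?thesis by (simp add: B inner_prod_def)
    qed
    have "fst (descent_ascent_field L (x', y')) = 0"
      by (rule euclidean_eqI) (simp add: vanish)
    then have "fst (gradient_on UNIV L (x', y')) = 0" by (simp add: descent_ascent_field_def)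
    then have "L (x', y') \<le> L (x, y')" for x using convex_part[OF cc, of x' y' x] by simp
    moreover have "x' = p" by (rule uniq[OF Lx'])
    ultimately show ?thesis using Ly' eq(1) by (auto simp: equilibria_def)
  next
    assume "strictly_concave (\<lambda>y. L (p, y))"
    then have sc: "strictly_convex (\<lambda>y. - L (p, y))" by (simp add: strictly_concave_def)
    have uniq: "y = q" if "L (p, y) = L (p, q)" for y
      by (rule strictly_convex_unique_minimiser[OF sc]) (use eq(1) that in auto)
    have vanish: "snd (descent_ascent_field L (x', y')) \<bullet> b = 0" if b: "b \<in> Basis" for b
    proof -
      have "descent_ascent_field L (coordwise k B) \<bullet> (0, b) = 0"
      proof (rule rate_vanishes_at_limit_point[OF attA u _ P_cont(2) P2_lim _ T(1,3)])
        show "(0, b) \<in> Basis" using b by (simp add: Basis_prod_def)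
        show "w \<bullet> (0, b) = coordwise k A \<bullet> (0, b)" if "P2 w = 0" for w
          using uniq[of "snd w"] that by (simp add: P2_def pq inner_prod_def)
      qed
      then show ?thesis by (simp add: B inner_prod_def)
    qed
    have "snd (descent_ascent_field L (x', y')) = 0"
      by (rule euclidean_eqI) (simp add: vanish)
    then have "snd (gradient_on UNIV L (x', y')) = 0" by (simp add: descent_ascent_field_def)
    then have "L (x', y) \<le> L (x', y')" for y using concave_part[OF cc, of x' y y'] by simp
    moreover have "y' = q" by (rule uniq[OF Ly'])
    ultimately show ?thesis using Lx' eq(2) by (auto simp: equilibria_def)
  qed
  then have "coordwise k B \<in> equilibria L" by (simp add: B)
  moreover have "(u \<longlongrightarrow> B) at_top"
    by (rule solution_converges_to_attracting_limit_point[OF equil_attracting[OF calculation] u T(2,3)])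
  ultimately show ?thesis using that by blast
qed

end

section \<open>Gradient descent ascent\<close>

lemma partial_x_eq:
  assumes "C2_on UNIV L"
  shows "partial_x L i (x, y) = fst (gradient_on UNIV L (x, y)) $ i"
proof -
  have "((\<lambda>s::real. x + s *\<^sub>R axis i 1) has_derivative (\<lambda>s. s *\<^sub>R axis i 1)) (at 0)"
    by (auto intro!: derivative_eq_intros)
  from has_derivative_compose[OF this, of "\<lambda>x. L (x, y)"]
  have "((\<lambda>s. L (x + s *\<^sub>R axis i 1, y)) has_derivative
      (\<lambda>s. fst (gradient_on UNIV L (x, y)) \<bullet> (s *\<^sub>R axis i 1))) (at 0)"
    using L_has_derivative_fst[OF assms, of y x] by (simp del: inner_scaleR_right)
  then have "((\<lambda>s. L (x + s *\<^sub>R axis i 1, y)) has_real_derivative fst (gradient_on UNIV L (x, y)) $ i) (at 0)"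
    unfolding has_field_derivative_def
    by (rule has_derivative_eq_rhs) (simp add: fun_eq_iff inner_axis mult.commute)
  then show ?thesis unfolding partial_x_def by (simp add: DERIV_imp_deriv)
qed

lemma partial_y_eq:
  assumes "C2_on UNIV L"
  shows "partial_y L j (x, y) = snd (gradient_on UNIV L (x, y)) $ j"
proof -
  have "((\<lambda>s::real. y + s *\<^sub>R axis j 1) has_derivative (\<lambda>s. s *\<^sub>R axis j 1)) (at 0)"
    by (auto intro!: derivative_eq_intros)
  from has_derivative_compose[OF this, of "\<lambda>y. L (x, y)"]
  have "((\<lambda>s. L (x, y + s *\<^sub>R axis j 1)) has_derivative
      (\<lambda>s. snd (gradient_on UNIV L (x, y)) \<bullet> (s *\<^sub>R axis j 1))) (at 0)"
    using L_has_derivative_snd[OF assms, of x y] by (simp del: inner_scaleR_right)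
  then have "((\<lambda>s. L (x, y + s *\<^sub>R axis j 1)) has_real_derivative snd (gradient_on UNIV L (x, y)) $ j) (at 0)"
    unfolding has_field_derivative_def
    by (rule has_derivative_eq_rhs) (simp add: fun_eq_iff inner_axis mult.commute)
  then show ?thesis unfolding partial_y_def by (simp add: DERIV_imp_deriv)
qed

lemma subspace_coord_space: "subspace (coord_space D)"
  by (auto simp: subspace_def coord_space_def)

text \<open>A basis vector of the product has exactly one nonzero component, which is an axis vector; its
index is the number of the block.\<close>

definition join_coords ::
    "('n::finite \<Rightarrow> 'c) \<Rightarrow> ('m::finite \<Rightarrow> 'c) \<Rightarrow> (real ^ 'n) \<times> (real ^ 'm) \<Rightarrow> 'c" where
  "join_coords kx ky b = (if snd b = 0 then kx (axis_index (fst b)) else ky (axis_index (snd b)))"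

lemma join_coords_axis [simp]:
  "join_coords kx ky (axis i 1, 0) = kx i" "join_coords kx ky (0, axis j 1) = ky j"
  by (simp_all add: join_coords_def axis_eq_0_iff)

lemma Basis_prod_vec_cases:
  assumes "b \<in> (Basis :: ((real ^ 'n) \<times> (real ^ 'm)) set)"
  obtains i where "b = (axis i 1, 0)" | j where "b = (0, axis j 1)"
  using assms by (auto simp: Basis_prod_def Basis_vec_def)

lemma coordwise_join_coords:
  "coordwise (join_coords kx ky) u = (\<chi> i. kx i (fst u $ i), \<chi> j. ky j (snd u $ j))"
proof (rule euclidean_eqI)
  fix b :: "(real ^ 'a) \<times> (real ^ 'b)" assume b: "b \<in> Basis"
  then show "coordwise (join_coords kx ky) u \<bullet> b =
      (\<chi> i. kx i (fst u $ i), \<chi> j. ky j (snd u $ j)) \<bullet> b"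
    unfolding coordwise_inner[OF b]
    by (cases rule: Basis_prod_vec_cases)
       (simp_all add: inner_prod_def inner_axis inner_axis')
qed

theorem theorem5:
  fixes D :: "'n::finite \<Rightarrow> 'd::finite set" and E :: "'m::finite \<Rightarrow> 'e::finite set"
    and f :: "'n \<Rightarrow> real ^ 'd \<Rightarrow> real" and g :: "'m \<Rightarrow> real ^ 'e \<Rightarrow> real"
    and L :: "(real ^ 'n) \<times> (real ^ 'm) \<Rightarrow> real"
    and \<theta>0 :: "real ^ 'd ^ 'n" and \<phi>0 :: "real ^ 'e ^ 'm"
    and Z :: "((real ^ 'n) \<times> (real ^ 'm)) set"
  assumes "\<And>i. D i \<noteq> {}" and "\<And>j. E j \<noteq> {}"
    and "\<And>i. C2_on (coord_space (D i)) (f i)"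
    and "\<And>j. C2_on (coord_space (E j)) (g j)"
    and "C2_on UNIV L"
    and "\<And>i. gradient_ascent_complete (coord_space (D i)) (f i)"
    and "\<And>j. gradient_ascent_complete (coord_space (E j)) (g j)"
    and "strictly_convex_concave L"
    and "\<And>i. \<theta>0 $ i \<in> coord_space (D i)" and "\<And>j. \<phi>0 $ j \<in> coord_space (E j)"
    and "Z = {(p, q) \<in> equilibria L. safe D E f g \<theta>0 \<phi>0 p q}"
    and "Z \<noteq> {}"
  shows "(\<exists>\<theta> \<phi>. GDA D E f g L \<theta>0 \<phi>0 \<theta> \<phi>) \<and>
    (\<forall>\<theta> \<phi>. GDA D E f g L \<theta>0 \<phi>0 \<theta> \<phi> \<longrightarrow>
       (\<exists>z\<in>Z. ((\<lambda>t. (apply_blocks f (\<theta> t), apply_blocks g (\<phi> t))) \<longlongrightarrow> z) at_top))"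
proof -
  note f = assms(3) and g = assms(4) and L = assms(5) and scc = assms(8)
  note S = subspace_coord_space
  obtain p q where pq: "(p, q) \<in> equilibria L" and safe: "safe D E f g \<theta>0 \<phi>0 p q"
    using assms(11,12) by auto
  obtain X where X: "\<And>i. gradient_ascent (coord_space (D i)) (f i) (\<theta>0 $ i) (X i)"
    using choice[OF allI, of "\<lambda>i. gradient_ascent (coord_space (D i)) (f i) (\<theta>0 $ i)"] assms(6,9)
    unfolding gradient_ascent_complete_def by blast
  obtain Y where Y: "\<And>j. gradient_ascent (coord_space (E j)) (g j) (\<phi>0 $ j) (Y j)"
    using choice[OF allI, of "\<lambda>j. gradient_ascent (coord_space (E j)) (g j) (\<phi>0 $ j)"] assms(7,10)
    unfolding gradient_ascent_complete_def by blast
  have X0: "X i 0 = \<theta>0 $ i" and Y0: "Y j 0 = \<phi>0 $ j" for i j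
    using X[of i] Y[of j] by (simp_all add: gradient_ascent_def)
  define k where "k = join_coords (\<lambda>i s. f i (X i s)) (\<lambda>j s. g j (Y j s))"
  define J where "J = descent_ascent_field L"
  have ns: "gradient_on (coord_space (D i)) (f i) (\<theta>0 $ i) \<noteq> 0"
    "gradient_on (coord_space (E j)) (g j) (\<phi>0 $ j) \<noteq> 0" for i j
    using safe by (auto simp: safe_def)
  have image: "ascent_image (coord_space (D i)) (f i) (\<theta>0 $ i) = range (\<lambda>s. f i (X i s))"
    "ascent_image (coord_space (E j)) (g j) (\<phi>0 $ j) = range (\<lambda>s. g j (Y j s))" for i j
    using profile_range[OF S f X] profile_range[OF S g Y] by auto
  have \<kappa>: "coordwise k u = (\<chi> i. f i (X i (fst u $ i)), \<chi> j. g j (Y j (snd u $ j)))" for u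
    unfolding k_def by (rule coordwise_join_coords)
  have flow: "monotone_flow k J"
  proof
    fix b :: "(real ^ 'n) \<times> (real ^ 'm)" and r :: real
    assume "b \<in> Basis"
    then show "strict_mono (k b)"
      by (cases rule: Basis_prod_vec_cases)
         (simp_all add: k_def profile_strict_mono[OF S f X ns(1)] profile_strict_mono[OF S g Y ns(2)])
    from \<open>b \<in> Basis\<close> show "\<exists>K. K-lipschitz_on {-r..r} (k b)"
      by (cases rule: Basis_prod_vec_cases)
         (simp_all add: k_def profile_lipschitz[OF S f X] profile_lipschitz[OF S g Y])
  next
    show "\<exists>K. K-lipschitz_on (cball 0 r) J" for r
      unfolding J_def by (rule descent_ascent_field_lipschitz[OF L])
  qed
  interpret monotone_flow k J by (rule flow)
  have "\<exists>A. coordwise k A = (p, q)"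
  proof -
    have "\<forall>i. \<exists>s. p $ i = f i (X i s)" "\<forall>j. \<exists>s. q $ j = g j (Y j s)"
      using safe unfolding safe_def image by auto
    then obtain a b where "\<And>i. p $ i = f i (X i (a i))" "\<And>j. q $ j = g j (Y j (b j))"
      by metis
    then have "coordwise k (\<chi> i. a i, \<chi> j. b j) = (p, q)"
      by (simp add: \<kappa> vec_eq_iff)
    then show ?thesis by blast
  qed
  then obtain A where A: "coordwise k A \<in> equilibria L" using pq by metis
  have J: "fst (J (x, y)) $ i = - partial_x L i (x, y)" "snd (J (x, y)) $ j = partial_y L j (x, y)" for x y i j
    by (simp_all add: J_def descent_ascent_field_def partial_x_eq[OF L] partial_y_eq[OF L])
  have comp: "((\<lambda>t. fst (u t) $ i) has_vector_derivative fst v $ i) (at t within T)"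
    "((\<lambda>t. snd (u t) $ j) has_vector_derivative snd v $ j) (at t within T)"
    if "(u has_vector_derivative v) (at t within T)" for u :: "real \<Rightarrow> (real ^ 'n) \<times> (real ^ 'm)" and v t T i j
    using that
    by (auto intro!: bounded_linear.has_vector_derivative[OF bounded_linear_vec_nth]
        bounded_linear.has_vector_derivative[OF bounded_linear_fst]
        bounded_linear.has_vector_derivative[OF bounded_linear_snd])
  have "\<exists>\<theta> \<phi>. GDA D E f g L \<theta>0 \<phi>0 \<theta> \<phi>"
  proof -
    have "attracting A"
      unfolding attracting_def
      using field_points_towards_equilibrium[OF L _ A] scc
      by (simp add: J_def strictly_convex_concave_def)
    then obtain u where u: "solution u" "u 0 = 0" by (rule solution_exists)
    define \<theta> where "\<theta> t = (\<chi> i. X i (fst (u t) $ i))" for t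
    define \<phi> where "\<phi> t = (\<chi> j. Y j (snd (u t) $ j))" for t
    have \<kappa>u: "coordwise k (u t) = (apply_blocks f (\<theta> t), apply_blocks g (\<phi> t))" for t
      by (simp add: \<kappa> \<theta>_def \<phi>_def apply_blocks_def)
    have "GDA D E f g L \<theta>0 \<phi>0 \<theta> \<phi>"
      unfolding GDA_def
    proof (intro conjI allI impI)
      show "\<theta> 0 = \<theta>0" "\<phi> 0 = \<phi>0" by (simp_all add: \<theta>_def \<phi>_def u X0 Y0 vec_eq_iff)
      fix t :: real assume t: "0 \<le> t"
      have du: "(u has_vector_derivative J (apply_blocks f (\<theta> t), apply_blocks g (\<phi> t))) (at t within {0..})"
        using u(1) t by (simp add: solution_def flip: \<kappa>u)
      show "\<theta> t $ i \<in> coord_space (D i)" for i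
        using X[of i] by (simp add: \<theta>_def gradient_ascent_def)
      show "\<phi> t $ j \<in> coord_space (E j)" for j
        using Y[of j] by (simp add: \<phi>_def gradient_ascent_def)
      show "((\<lambda>s. \<theta> s $ i) has_vector_derivative
          - (partial_x L i (apply_blocks f (\<theta> t), apply_blocks g (\<phi> t)) *\<^sub>R
             gradient_on (coord_space (D i)) (f i) (\<theta> t $ i))) (at t within {0..})" for i
        using gradient_ascent_reparametrised[OF X comp(1)[OF du]] by (simp add: \<theta>_def J)
      show "((\<lambda>s. \<phi> s $ j) has_vector_derivative
          partial_y L j (apply_blocks f (\<theta> t), apply_blocks g (\<phi> t)) *\<^sub>R
             gradient_on (coord_space (E j)) (g j) (\<phi> t $ j)) (at t within {0..})" for j
        using gradient_ascent_reparametrised[OF Y comp(2)[OF du]] by (simp add: \<phi>_def J)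
    qed
    then show ?thesis by blast
  qed
  moreover have "\<exists>z\<in>Z. ((\<lambda>t. (apply_blocks f (\<theta> t), apply_blocks g (\<phi> t))) \<longlongrightarrow> z) at_top"
    if GDA: "GDA D E f g L \<theta>0 \<phi>0 \<theta> \<phi>" for \<theta> \<phi>
  proof -
    define w where "w t = (apply_blocks f (\<theta> t), apply_blocks g (\<phi> t))" for t
    have init: "\<theta> 0 = \<theta>0" "\<phi> 0 = \<phi>0" using GDA by (auto simp: GDA_def)
    have mem: "\<theta> t $ i \<in> coord_space (D i)" "\<phi> t $ j \<in> coord_space (E j)"
      and der: "((\<lambda>s. \<theta> s $ i) has_vector_derivative
          fst (J (w t)) $ i *\<^sub>R gradient_on (coord_space (D i)) (f i) (\<theta> t $ i)) (at t within {0..})"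
        "((\<lambda>s. \<phi> s $ j) has_vector_derivative
          snd (J (w t)) $ j *\<^sub>R gradient_on (coord_space (E j)) (g j) (\<phi> t $ j)) (at t within {0..})"
      if "t \<ge> 0" for t i j
      using GDA that by (auto simp: GDA_def w_def J)
    have cont_block: "continuous_on {0..} (\<lambda>t. h (y t))"
      if "subspace T" "C2_on T h" "\<And>t. t \<ge> 0 \<Longrightarrow> y t \<in> T"
        "\<And>t. t \<ge> 0 \<Longrightarrow> (y has_vector_derivative y' t) (at t within {0..})"
      for T h and y y' :: "real \<Rightarrow> real ^ 'i::finite"
    proof (rule continuous_on_compose2[of T h])
      show "continuous_on T h"
        using has_derivative_continuous[OF gradient_on_has_derivative[OF that(1,2)]]
        by (simp add: continuous_on_eq_continuous_within)
      show "continuous_on {0..} y"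
        using has_vector_derivative_continuous[OF that(4)]
        by (simp add: continuous_on_eq_continuous_within)
      show "y ` {0..} \<subseteq> T" using that(3) by auto
    qed
    have "continuous_on {0..} (\<lambda>t. f i (\<theta> t $ i))" for i
      by (rule cont_block[OF S f mem(1) der(1)])
    moreover have "continuous_on {0..} (\<lambda>t. g j (\<phi> t $ j))" for j
      by (rule cont_block[OF S g mem(2) der(2)])
    ultimately have "continuous_on {0..} w"
      unfolding w_def[abs_def] apply_blocks_def by (intro continuous_intros)
    then have contJ: "continuous_on {0..} (\<lambda>t. J (w t))"
      by (rule continuous_on_compose2[OF continuous_J]) auto
    \<comment> \<open>the clocks of all blocks at once: the field along the given solution is integrated\<close>
    obtain u where u: "u 0 = 0"
      "\<And>t. t \<ge> 0 \<Longrightarrow> (u has_vector_derivative J (w t)) (at t within {0..})"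
      using half_line_antiderivative[OF contJ] by blast
    have \<theta>: "\<theta> t $ i = X i (fst (u t) $ i)" if "t \<ge> 0" for t i
      by (rule reparametrised_ascent_unique[where a = "\<lambda>t. fst (u t) $ i" and y = "\<lambda>t. \<theta> t $ i",
            OF S f X _ comp(1)[OF u(2)] mem(1) der(1) _ that])
         (auto simp: init u(1) X0 intro!: continuous_intros contJ)
    have \<phi>: "\<phi> t $ j = Y j (snd (u t) $ j)" if "t \<ge> 0" for t j
      by (rule reparametrised_ascent_unique[where a = "\<lambda>t. snd (u t) $ j" and y = "\<lambda>t. \<phi> t $ j",
            OF S g Y _ comp(2)[OF u(2)] mem(2) der(2) _ that])
         (auto simp: init u(1) Y0 intro!: continuous_intros contJ)
    have w: "w t = coordwise k (u t)" if "t \<ge> 0" for t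
      using that by (simp add: w_def \<kappa> apply_blocks_def \<theta> \<phi>)
    have sol: "solution u" unfolding solution_def using u(2) w by simp
    obtain B where B: "(u \<longlongrightarrow> B) at_top" "coordwise k B \<in> equilibria L"
      by (rule saddle_flow_converges[OF L flow[unfolded J_def] scc A sol[unfolded J_def]])
    have "isCont (coordwise k) B"
      using continuous_\<kappa> continuous_on_eq_continuous_at[OF open_UNIV] by blast
    then have "((\<lambda>t. coordwise k (u t)) \<longlongrightarrow> coordwise k B) at_top"
      using B(1) by (rule isCont_tendsto_compose)
    moreover have "\<forall>\<^sub>F t in at_top. coordwise k (u t) = w t"
      using eventually_ge_at_top[of 0] by (rule eventually_mono) (simp add: w)
    ultimately have "(w \<longlongrightarrow> coordwise k B) at_top" by (rule Lim_transform_eventually)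
    moreover have "coordwise k B \<in> Z"
      using B(2) unfolding assms(11) \<kappa> by (auto simp: safe_def ns image)
    ultimately show ?thesis unfolding w_def[abs_def] by blast
  qed
  ultimately show ?thesis by blast
qed

end
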